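(* Let $n\ge3$ and $\mathbf{char}(q)=\ell\ge3$. Let $\wedge_q(n)_{(1)}=\mathrm{span}_k\{dx_1,\dots,dx_n\}$ be given the $\mathfrak u_q(\mathfrak{sl}_n)$-module structure of $V(\lambda_1)$ with highest weight vector $dx_1$, namely $e_i.dx_j=\delta_{i+1,j}dx_i$, $f_i.dx_j=\delta_{ij}dx_{i+1}$, $K_i.dx_j=q^{\delta_{ij}-\delta_{i+1,j}}dx_j$. Then the $q$-differential $d:\mathcal A_q(n)\to\mathcal A_q(n)\otimes_k\wedge_q(n)_{(1)}$, $$dx^{(\alpha)}=\sum_{i=1}^nq^{-\varepsilon_i*\alpha}x^{(\alpha-\varepsilon_i)}\otimes dx_i,$$ is a $\mathfrak u_q(\mathfrak{sl}_n)$-module homomorphism, i.e. $d(u.x)=u.dx$ for all $u\in\mathfrak u_q(\mathfrak{sl}_n)$ and $x\in\mathcal A_q(n)$.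
   Context: $k$ is an algebraically closed field of characteristic $0$ and $q\in k^*$, $q\ne\pm1$. $[a]=\frac{q^a-q^{-a}}{q-q^{-1}}$; $\mathbf{char}(q)$ is the smallest positive integer $\ell$ with $[\ell]=0$ (so $q$ is either a primitive $2\ell$-th root of unity, or $\ell$ is odd and $q$ is a primitive $\ell$-th root of unity). $U_q(\mathfrak{sl}_n)$ is the usual quantum group with generators $e_i,f_i,K_i^{\pm1}$ ($1\le i\le n-1$) and coproduct $\Delta(K_i^{\pm1})=K_i^{\pm1}\otimes K_i^{\pm1}$, $\Delta(e_i)=e_i\otimes K_i+1\otimes e_i$, $\Delta(f_i)=f_i\otimes1+K_i^{-1}\otimes f_i$. $\mathfrak u_q(\mathfrak{sl}_n)=U_q(\mathfrak{sl}_n)/(e_i^\ell,f_i^\ell,K_i^{2\ell}-1)$. Tensor products of modules carry the action through $\Delta$. $\mathcal A_q(n)$ is the $k$-vector space with basis $\{x^{(\alpha)}\mid\alpha\in\mathbb Z_+^n\}$ ($\mathbb Z_+$ = nonnegative integers); $x^{(\beta)}:=0$ if $\beta\notin\mathbb Z_+^n$; $\varepsilon_i$ is the $i$-th unit vector; $\mathfrak u_q(\mathfrak{sl}_n)$ acts by $e_i.x^{(\beta)}=[\beta_i+1]x^{(\beta+\varepsilon_i-\varepsilon_{i+1})}$, $f_i.x^{(\beta)}=[\beta_{i+1}+1]x^{(\beta-\varepsilon_i+\varepsilon_{i+1})}$, $K_i^{\pm1}.x^{(\beta)}=q^{\pm(\beta_i-\beta_{i+1})}x^{(\beta)}$. For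 $\alpha,\beta\in\mathbb Z^n$, $\alpha*\beta=\sum_{j=1}^{n-1}\sum_{i>j}\alpha_i\beta_j$, so $\varepsilon_i*\alpha=\sum_{j<i}\alpha_j$. *)

theory Defs
  imports
    "HOL-Library.Poly_Mapping"
    "HOL-Library.Product_Plus"
    "HOL-Library.Function_Algebras"
    "HOL-Computational_Algebra.Polynomial"
    "HOL-Algebra.QuotRing"
begin

section \<open>Quantum integers\<close>

definition qint :: "'k::field \<Rightarrow> int \<Rightarrow> 'k" where
  "qint q a = (q powi a - q powi (- a)) / (q - inverse q)"

text \<open>The value 0 stands for ``no such positive integer exists'' (q is not a root of unity).\<close>

definition qchar :: "'k::field \<Rightarrow> nat" where
  "qchar q =
    (if \<exists>l>0. qint q (int l) = 0 then LEAST l. 0 < l \<and> qint q (int l) = 0 else 0)"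

section \<open>Vector spaces with a basis\<close>

text \<open>The finitely supported functions \<open>'b \<Rightarrow>\<^sub>0 'k\<close> are the vector space over \<open>'k\<close> with basis
  \<open>single b 1\<close>; the tensor product of two such spaces is the space with basis the pairs.\<close>

definition scale :: "'k::field \<Rightarrow> ('b \<Rightarrow>\<^sub>0 'k) \<Rightarrow> ('b \<Rightarrow>\<^sub>0 'k)" where
  "scale c v = Poly_Mapping.map ((*) c) v"

lemma lookup_scale [simp]: "Poly_Mapping.lookup (scale c v) b = c * Poly_Mapping.lookup v b"
  by (simp add: scale_def Poly_Mapping.map.rep_eq when_def)

lemma vector_space_scale: "vector_space (scale :: 'k::field \<Rightarrow> ('b \<Rightarrow>\<^sub>0 'k) \<Rightarrow> _)"
  by standard (auto intro!: poly_mapping_eqI simp: lookup_add algebra_simps)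

definition lin_ext :: "('b \<Rightarrow> ('c \<Rightarrow>\<^sub>0 'k)) \<Rightarrow> ('b \<Rightarrow>\<^sub>0 'k::field) \<Rightarrow> ('c \<Rightarrow>\<^sub>0 'k)" where
  "lin_ext f v = (\<Sum>b\<in>Poly_Mapping.keys v. scale (Poly_Mapping.lookup v b) (f b))"

definition tensor :: "('b \<Rightarrow>\<^sub>0 'k) \<Rightarrow> ('c \<Rightarrow>\<^sub>0 'k) \<Rightarrow> ('b \<times> 'c \<Rightarrow>\<^sub>0 'k::field)" where
  "tensor v w = (\<Sum>b\<in>Poly_Mapping.keys v. \<Sum>c\<in>Poly_Mapping.keys w.
    Poly_Mapping.single (b, c) (Poly_Mapping.lookup v b * Poly_Mapping.lookup w c))"

definition tensor_map ::
  "(('b \<Rightarrow>\<^sub>0 'k) \<Rightarrow> ('b \<Rightarrow>\<^sub>0 'k)) \<Rightarrow> (('c \<Rightarrow>\<^sub>0 'k) \<Rightarrow> ('c \<Rightarrow>\<^sub>0 'k))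
    \<Rightarrow> ('b \<times> 'c \<Rightarrow>\<^sub>0 'k::field) \<Rightarrow> ('b \<times> 'c \<Rightarrow>\<^sub>0 'k)" where
  "tensor_map S T =
    lin_ext (\<lambda>(b, c). tensor (S (Poly_Mapping.single b 1)) (T (Poly_Mapping.single c 1)))"

section \<open>The free algebra on the generators\<close>

datatype 'a free_monoid = Word (letters: "'a list")

instantiation free_monoid :: (type) monoid_add
begin

definition zero_free_monoid :: "'a free_monoid" where
  "0 = Word []"

definition plus_free_monoid :: "'a free_monoid \<Rightarrow> 'a free_monoid \<Rightarrow> 'a free_monoid" where
  "v + w = Word (letters v @ letters w)"

instance
  by standard (simp_all add: zero_free_monoid_def plus_free_monoid_def)

end

text \<open>\<open>GenKinv i\<close> is the inverse of \<open>GenK i\<close>.  The generators of the rank \<open>n - 1\<close> quantum group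
  are those with index between 1 and \<open>n - 1\<close>.\<close>

datatype gen = GenE nat | GenF nat | GenK nat | GenKinv nat

fun gen_index :: "gen \<Rightarrow> nat" where
  "gen_index (GenE i) = i"
| "gen_index (GenF i) = i"
| "gen_index (GenK i) = i"
| "gen_index (GenKinv i) = i"

text \<open>The multiplication of the type \<open>gen free_monoid \<Rightarrow>\<^sub>0 'k\<close> is the convolution product, i.e.
  this type is the free associative algebra on \<open>gen\<close>; likewise
  \<open>gen free_monoid \<times> gen free_monoid \<Rightarrow>\<^sub>0 'k\<close> is its tensor square, as an algebra.\<close>

type_synonym 'k falg = "gen free_monoid \<Rightarrow>\<^sub>0 'k"
type_synonym 'k falg2 = "gen free_monoid \<times> gen free_monoid \<Rightarrow>\<^sub>0 'k"

definition falg_gen :: "gen \<Rightarrow> 'k::field falg" where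
  "falg_gen g = Poly_Mapping.single (Word [g]) 1"

definition free_alg :: "nat \<Rightarrow> 'k::field falg ring" where
  "free_alg n =
    \<lparr>carrier = {u. \<forall>w\<in>Poly_Mapping.keys u. \<forall>g\<in>set (letters w). gen_index g \<in> {1..n-1}},
     mult = (*), one = 1, zero = 0, add = (+)\<rparr>"

lemma ring_free_alg: "ring (free_alg n :: 'k::field falg ring)"
proof -
  define C where
    "C = {u :: 'k falg. \<forall>w\<in>Poly_Mapping.keys u. \<forall>g\<in>set (letters w). gen_index g \<in> {1..n-1}}"
  have add: "u + v \<in> C" if "u \<in> C" "v \<in> C" for u v
    using that Poly_Mapping.keys_add[of u v] unfolding C_def by blast
  have mult: "u * v \<in> C" if "u \<in> C" "v \<in> C" for u v
  proof -
    have "gen_index g \<in> {1..n-1}"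
      if w: "w \<in> Poly_Mapping.keys (u * v)" and g: "g \<in> set (letters w)" for w g
    proof -
      obtain a b where "a \<in> Poly_Mapping.keys u" "b \<in> Poly_Mapping.keys v" "w = a + b"
        using keys_mult[of u v] w by blast
      with g \<open>u \<in> C\<close> \<open>v \<in> C\<close> show ?thesis
        unfolding C_def plus_free_monoid_def by auto
    qed
    then show ?thesis
      unfolding C_def by blast
  qed
  have zero: "0 \<in> C" and one: "1 \<in> C"
    by (simp_all add: C_def zero_free_monoid_def)
  have uminus: "- u \<in> C" if "u \<in> C" for u
    using that by (simp add: C_def)
  have eq: "free_alg n = \<lparr>carrier = C, mult = (*), one = 1, zero = 0, add = (+)\<rparr>"
    by (simp add: free_alg_def C_def)
  have inv: "\<exists>v\<in>C. u + v = 0" if "u \<in> C" for u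
    by (rule bexI[of _ "- u"]) (simp_all add: uminus that)
  show ?thesis
    unfolding eq
    by (intro ringI abelian_groupI monoidI; simp only: ring_record_simps partial_object.simps monoid.simps)
       (simp_all only: add mult zero one inv ac_simps mult_1_left mult_1_right add_0_left add_0_right
         distrib_left distrib_right)
qed

section \<open>The quantum groups\<close>

definition cartan :: "nat \<Rightarrow> nat \<Rightarrow> int" where
  "cartan i j = (if i = j then 2 else if i = j + 1 \<or> j = i + 1 then -1 else 0)"

text \<open>Each relation is written as an element of the free algebra that is to vanish.\<close>

definition Uq_relations :: "'k::field \<Rightarrow> nat \<Rightarrow> 'k falg set" where
  "Uq_relations q n =
    (let I = {1..n-1};
         e = (\<lambda>i. falg_gen (GenE i)); f = (\<lambda>i. falg_gen (GenF i));
         K = (\<lambda>i. falg_gen (GenK i)); Kinv = (\<lambda>i. falg_gen (GenKinv i))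
     in {K i * Kinv i - 1 | i. i \<in> I}
      \<union> {Kinv i * K i - 1 | i. i \<in> I}
      \<union> {K i * K j - K j * K i | i j. i \<in> I \<and> j \<in> I}
      \<union> {K i * e j * Kinv i - scale (q powi cartan i j) (e j) | i j. i \<in> I \<and> j \<in> I}
      \<union> {K i * f j * Kinv i - scale (q powi (- cartan i j)) (f j) | i j. i \<in> I \<and> j \<in> I}
      \<union> {e i * f i - f i * e i - scale (inverse (q - inverse q)) (K i - Kinv i) | i. i \<in> I}
      \<union> {e i * f j - f j * e i | i j. i \<in> I \<and> j \<in> I \<and> i \<noteq> j}
      \<union> {e i * e j - e j * e i | i j. i \<in> I \<and> j \<in> I \<and> cartan i j = 0}
      \<union> {f i * f j - f j * f i | i j. i \<in> I \<and> j \<in> I \<and> cartan i j = 0}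
      \<union> {e i * e i * e j - scale (q + inverse q) (e i * e j * e i) + e j * e i * e i
           | i j. i \<in> I \<and> j \<in> I \<and> cartan i j = -1}
      \<union> {f i * f i * f j - scale (q + inverse q) (f i * f j * f i) + f j * f i * f i
           | i j. i \<in> I \<and> j \<in> I \<and> cartan i j = -1})"

definition Uq_ideal :: "'k::field \<Rightarrow> nat \<Rightarrow> 'k falg set" where
  "Uq_ideal q n = Idl\<^bsub>free_alg n\<^esub> (Uq_relations q n)"

definition Uq :: "'k::field \<Rightarrow> nat \<Rightarrow> 'k falg set ring" where
  "Uq q n = free_alg n Quot Uq_ideal q n"

definition Uq_gen :: "'k::field \<Rightarrow> nat \<Rightarrow> gen \<Rightarrow> 'k falg set" where
  "Uq_gen q n g = Uq_ideal q n +>\<^bsub>free_alg n\<^esub> falg_gen g"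

definition small_uq :: "'k::field \<Rightarrow> nat \<Rightarrow> nat \<Rightarrow> 'k falg set set ring" where
  "small_uq q l n = Uq q n Quot (Idl\<^bsub>Uq q n\<^esub>
     ({Uq_gen q n (GenE i) [^]\<^bsub>Uq q n\<^esub> l | i. i \<in> {1..n-1}}
    \<union> {Uq_gen q n (GenF i) [^]\<^bsub>Uq q n\<^esub> l | i. i \<in> {1..n-1}}
    \<union> {Uq_gen q n (GenK i) [^]\<^bsub>Uq q n\<^esub> (2 * l) \<ominus>\<^bsub>Uq q n\<^esub> \<one>\<^bsub>Uq q n\<^esub> | i. i \<in> {1..n-1}}))"

section \<open>Modules\<close>

text \<open>A family of operators, one for each generator, makes a vector space a module over the free
  algebra.\<close>

definition word_act ::
  "(gen \<Rightarrow> ('b \<Rightarrow>\<^sub>0 'k) \<Rightarrow> ('b \<Rightarrow>\<^sub>0 'k)) \<Rightarrow> gen free_monoid \<Rightarrow> ('b \<Rightarrow>\<^sub>0 'k::field) \<Rightarrow> ('b \<Rightarrow>\<^sub>0 'k)"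
where
  "word_act op w = foldr op (letters w)"

definition falg_act ::
  "(gen \<Rightarrow> ('b \<Rightarrow>\<^sub>0 'k) \<Rightarrow> ('b \<Rightarrow>\<^sub>0 'k)) \<Rightarrow> 'k::field falg \<Rightarrow> ('b \<Rightarrow>\<^sub>0 'k) \<Rightarrow> ('b \<Rightarrow>\<^sub>0 'k)"
where
  "falg_act op u v = (\<Sum>w\<in>Poly_Mapping.keys u. scale (Poly_Mapping.lookup u w) (word_act op w v))"

definition falg2_act ::
  "(gen \<Rightarrow> ('b \<Rightarrow>\<^sub>0 'k) \<Rightarrow> ('b \<Rightarrow>\<^sub>0 'k)) \<Rightarrow> (gen \<Rightarrow> ('c \<Rightarrow>\<^sub>0 'k) \<Rightarrow> ('c \<Rightarrow>\<^sub>0 'k))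
    \<Rightarrow> 'k::field falg2 \<Rightarrow> ('b \<times> 'c \<Rightarrow>\<^sub>0 'k) \<Rightarrow> ('b \<times> 'c \<Rightarrow>\<^sub>0 'k)"
where
  "falg2_act op op' t v =
    (\<Sum>w\<in>Poly_Mapping.keys t. scale (Poly_Mapping.lookup t w)
       (tensor_map (word_act op (fst w)) (word_act op' (snd w)) v))"

text \<open>The comultiplication on the free algebra: the algebra homomorphism into the tensor square
  with the prescribed values on the generators.\<close>

fun comult_gen :: "gen \<Rightarrow> 'k::field falg2" where
  "comult_gen (GenE i) = tensor (falg_gen (GenE i)) (falg_gen (GenK i)) + tensor 1 (falg_gen (GenE i))"
| "comult_gen (GenF i) = tensor (falg_gen (GenF i)) 1 + tensor (falg_gen (GenKinv i)) (falg_gen (GenF i))"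
| "comult_gen (GenK i) = tensor (falg_gen (GenK i)) (falg_gen (GenK i))"
| "comult_gen (GenKinv i) = tensor (falg_gen (GenKinv i)) (falg_gen (GenKinv i))"

definition comult :: "'k::field falg \<Rightarrow> 'k falg2" where
  "comult = lin_ext (\<lambda>w. prod_list (map comult_gen (letters w)))"

definition falg_tensor_act ::
  "(gen \<Rightarrow> ('b \<Rightarrow>\<^sub>0 'k) \<Rightarrow> ('b \<Rightarrow>\<^sub>0 'k)) \<Rightarrow> (gen \<Rightarrow> ('c \<Rightarrow>\<^sub>0 'k) \<Rightarrow> ('c \<Rightarrow>\<^sub>0 'k))
    \<Rightarrow> 'k::field falg \<Rightarrow> ('b \<times> 'c \<Rightarrow>\<^sub>0 'k) \<Rightarrow> ('b \<times> 'c \<Rightarrow>\<^sub>0 'k)"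
where
  "falg_tensor_act op op' u = falg2_act op op' (comult u)"

text \<open>The action induced on a quotient ring, whose elements are cosets: the common value of the
  action of all representatives.\<close>

definition quot_act :: "('r \<Rightarrow> 'v \<Rightarrow> 'v) \<Rightarrow> 'r set \<Rightarrow> 'v \<Rightarrow> 'v" where
  "quot_act act C v = the_elem ((\<lambda>u. act u v) ` C)"

text \<open>Elements of the small quantum group are cosets of cosets, hence the two descents.\<close>

definition uq_act ::
  "(gen \<Rightarrow> ('b \<Rightarrow>\<^sub>0 'k) \<Rightarrow> ('b \<Rightarrow>\<^sub>0 'k)) \<Rightarrow> 'k::field falg set set \<Rightarrow> ('b \<Rightarrow>\<^sub>0 'k) \<Rightarrow> ('b \<Rightarrow>\<^sub>0 'k)"
where
  "uq_act op = quot_act (quot_act (falg_act op))"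

definition uq_tensor_act ::
  "(gen \<Rightarrow> ('b \<Rightarrow>\<^sub>0 'k) \<Rightarrow> ('b \<Rightarrow>\<^sub>0 'k)) \<Rightarrow> (gen \<Rightarrow> ('c \<Rightarrow>\<^sub>0 'k) \<Rightarrow> ('c \<Rightarrow>\<^sub>0 'k))
    \<Rightarrow> 'k::field falg set set \<Rightarrow> ('b \<times> 'c \<Rightarrow>\<^sub>0 'k) \<Rightarrow> ('b \<times> 'c \<Rightarrow>\<^sub>0 'k)"
where
  "uq_tensor_act op op' = quot_act (quot_act (falg_tensor_act op op'))"

section \<open>The quantum divided power algebra and the one-forms\<close>

text \<open>Elements of \<open>\<int>\<^sup>n\<close> are functions \<open>nat \<Rightarrow> int\<close> vanishing outside \<open>{1..n}\<close>.\<close>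

definition Zplus :: "nat \<Rightarrow> (nat \<Rightarrow> int) set" where
  "Zplus n = {\<alpha>. (\<forall>i\<in>{1..n}. 0 \<le> \<alpha> i) \<and> (\<forall>i. i \<notin> {1..n} \<longrightarrow> \<alpha> i = 0)}"

definition eps :: "nat \<Rightarrow> nat \<Rightarrow> int" where
  "eps i = (\<lambda>j. if j = i then 1 else 0)"

definition star :: "nat \<Rightarrow> (nat \<Rightarrow> int) \<Rightarrow> (nat \<Rightarrow> int) \<Rightarrow> int" where
  "star n \<alpha> \<beta> = (\<Sum>j=1..n-1. \<Sum>i=j+1..n. \<alpha> i * \<beta> j)"

definition Aq :: "nat \<Rightarrow> ((nat \<Rightarrow> int) \<Rightarrow>\<^sub>0 'k::field) set" where
  "Aq n = {x. Poly_Mapping.keys x \<subseteq> Zplus n}"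

definition xpow :: "nat \<Rightarrow> (nat \<Rightarrow> int) \<Rightarrow> ((nat \<Rightarrow> int) \<Rightarrow>\<^sub>0 'k::field)" where
  "xpow n \<beta> = (if \<beta> \<in> Zplus n then Poly_Mapping.single \<beta> 1 else 0)"

fun Aq_gen_basis :: "'k::field \<Rightarrow> nat \<Rightarrow> gen \<Rightarrow> (nat \<Rightarrow> int) \<Rightarrow> ((nat \<Rightarrow> int) \<Rightarrow>\<^sub>0 'k)" where
  "Aq_gen_basis q n (GenE i) \<beta> = scale (qint q (\<beta> i + 1)) (xpow n (\<beta> + eps i - eps (i+1)))"
| "Aq_gen_basis q n (GenF i) \<beta> = scale (qint q (\<beta> (i+1) + 1)) (xpow n (\<beta> - eps i + eps (i+1)))"
| "Aq_gen_basis q n (GenK i) \<beta> = scale (q powi (\<beta> i - \<beta> (i+1))) (xpow n \<beta>)"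
| "Aq_gen_basis q n (GenKinv i) \<beta> = scale (q powi (- (\<beta> i - \<beta> (i+1)))) (xpow n \<beta>)"

definition Aq_op ::
  "'k::field \<Rightarrow> nat \<Rightarrow> gen \<Rightarrow> ((nat \<Rightarrow> int) \<Rightarrow>\<^sub>0 'k) \<Rightarrow> ((nat \<Rightarrow> int) \<Rightarrow>\<^sub>0 'k)" where
  "Aq_op q n g = lin_ext (Aq_gen_basis q n g)"

definition dx :: "nat \<Rightarrow> (nat \<Rightarrow>\<^sub>0 'k::field)" where
  "dx i = Poly_Mapping.single i 1"

fun Lambda1_gen_basis :: "'k::field \<Rightarrow> gen \<Rightarrow> nat \<Rightarrow> (nat \<Rightarrow>\<^sub>0 'k)" where
  "Lambda1_gen_basis q (GenE i) j = (if i + 1 = j then dx i else 0)"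
| "Lambda1_gen_basis q (GenF i) j = (if i = j then dx (i+1) else 0)"
| "Lambda1_gen_basis q (GenK i) j = scale (q powi (of_bool (i = j) - of_bool (i + 1 = j))) (dx j)"
| "Lambda1_gen_basis q (GenKinv i) j =
     scale (q powi (- (of_bool (i = j) - of_bool (i + 1 = j)))) (dx j)"

definition Lambda1_op :: "'k::field \<Rightarrow> gen \<Rightarrow> (nat \<Rightarrow>\<^sub>0 'k) \<Rightarrow> (nat \<Rightarrow>\<^sub>0 'k)" where
  "Lambda1_op q g = lin_ext (Lambda1_gen_basis q g)"

definition Aq_tensor_Lambda1 :: "nat \<Rightarrow> ((nat \<Rightarrow> int) \<times> nat \<Rightarrow>\<^sub>0 'k::field) set" where
  "Aq_tensor_Lambda1 n = {y. Poly_Mapping.keys y \<subseteq> Zplus n \<times> {1..n}}"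

definition qdiff ::
  "'k::field \<Rightarrow> nat \<Rightarrow> ((nat \<Rightarrow> int) \<Rightarrow>\<^sub>0 'k) \<Rightarrow> ((nat \<Rightarrow> int) \<times> nat \<Rightarrow>\<^sub>0 'k)" where
  "qdiff q n = lin_ext (\<lambda>\<alpha>.
     \<Sum>i=1..n. scale (q powi (- star n (eps i) \<alpha>)) (tensor (xpow n (\<alpha> - eps i)) (dx i)))"

end

(* Two observations reduce everything to coefficients.  First, the formulas for e_i, f_i, K_i and d on
   x^(beta) remain valid for all beta in Z^n (with x^(beta) = 0 outside Z_+^n), so the defining relations
   of the quantum group on A_q(n), and d(g.x) = g.dx for a generator g, become identities between
   quantum integers: [a+1] = q[a] + q^(-a), [a+2] + [a] = (q + q^(-1))[a+1], and the vanishing of a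
   product of l consecutive quantum integers.  Second, compatibility with generators passes to the free
   algebra, and from there to the quotients: a coset acts on x in a single way, hence so does it on dx,
   and the comultiplication need not be shown to respect the relations. *)

theory Submission
  imports Defs
begin

section \<open>Linear maps on spaces with a basis\<close>

text \<open>The ambient types are larger than the modules: a basis vector whose exponent lies
  outside \<open>Zplus n\<close> is sent to 0 by \<open>K_i\<close> and by its inverse, so the
  relations fail on it, and there \<open>the_elem\<close> in \<open>quot_act\<close> has no meaning
  to rely on. Hence ring actions are studied relative to a subset \<open>M\<close>, here
  \<open>Aq n\<close>. The ring elements that kill \<open>M\<close> form a two-sided ideal, so an
  ideal kills \<open>M\<close> as soon as its generators do; this is applied over the free algebra
  and again over \<open>Uq\<close>. The twist in d is what makes the coproduct fit. Passing from the
  coefficient of \<open>dx i\<close> to that of \<open>dx (i+1)\<close> multiplies by q^(-a) with a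
  the i-th exponent, which is the correction in [a+1] = q[a] + q^(-a). It absorbs the single summand
  by which e_i fails to act on dx^(\<beta>) term by term; for f_i the factor K_i^(-1) in the
  coproduct supplies the power needed on the other side.\<close>

abbreviation klinear :: "(('b \<Rightarrow>\<^sub>0 'k::field) \<Rightarrow> ('c \<Rightarrow>\<^sub>0 'k)) \<Rightarrow> bool" where
  "klinear \<equiv> Vector_Spaces.linear scale scale"

lemma klinear_iff:
  "klinear f \<longleftrightarrow> (\<forall>x y. f (x + y) = f x + f y) \<and> (\<forall>c x. f (scale c x) = scale c (f x))"
  unfolding linear_iff_module_hom module_hom_iff module_iff_vector_space
  by (intro iffI conjI vector_space_scale; elim conjE; assumption)

lemma
  assumes "klinear f"
  shows klinear_add: "f (x + y) = f x + f y"
    and klinear_scale: "f (scale c x) = scale c (f x)"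
    and klinear_zero: "f 0 = 0"
    and klinear_diff: "f (x - y) = f x - f y"
    and klinear_sum: "f (sum g A) = (\<Sum>a\<in>A. f (g a))"
proof -
  have f: "module_hom scale scale f"
    using assms by (simp add: linear_iff_module_hom)
  show "f (x + y) = f x + f y" by (rule module_hom.add[OF f])
  show "f (scale c x) = scale c (f x)" by (rule module_hom.scale[OF f])
  show "f 0 = 0" by (rule module_hom.zero[OF f])
  show "f (x - y) = f x - f y" by (rule module_hom.diff[OF f])
  show "f (sum g A) = (\<Sum>a\<in>A. f (g a))" by (rule module_hom.sum[OF f])
qed

lemma
  shows scale_zero_left [simp]: "scale 0 v = 0"
    and scale_zero_right [simp]: "scale c 0 = 0"
    and scale_one [simp]: "scale 1 v = v"
    and scale_scale [simp]: "scale c (scale d v) = scale (c * d) v"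
    and scale_add_left: "scale (c + d) v = scale c v + scale d v"
    and scale_add_right: "scale c (v + w) = scale c v + scale c w"
    and scale_diff_left: "scale (c - d) v = scale c v - scale d v"
    and scale_single [simp]: "scale c (Poly_Mapping.single b d) = Poly_Mapping.single b (c * d)"
  by (auto intro!: poly_mapping_eqI
      simp: lookup_add lookup_minus lookup_single when_def algebra_simps)

lemma scale_sum_right: "scale c (sum f A) = (\<Sum>a\<in>A. scale c (f a))"
  by (rule poly_mapping_eqI) (simp add: lookup_sum sum_distrib_left)

lemma klinear_comp: "klinear f \<Longrightarrow> klinear g \<Longrightarrow> klinear (\<lambda>x. f (g x))"
  by (simp add: klinear_iff)

text \<open>The supports of \<open>v\<close>, \<open>w\<close> and \<open>v + w\<close> differ; a
  common finite index set makes the three sums comparable term by term.\<close>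

lemma lin_ext_superset:
  assumes "finite A" and "Poly_Mapping.keys v \<subseteq> A"
  shows "lin_ext f v = (\<Sum>b\<in>A. scale (Poly_Mapping.lookup v b) (f b))"
  unfolding lin_ext_def using assms
  by (intro sum.mono_neutral_left) (auto simp: in_keys_iff)

lemma klinear_lin_ext:
  fixes f :: "'b \<Rightarrow> ('c \<Rightarrow>\<^sub>0 'k::field)"
  shows "klinear (lin_ext f)"
  unfolding klinear_iff
proof (intro conjI allI)
  fix v w :: "'b \<Rightarrow>\<^sub>0 'k" and c :: 'k
  let ?A = "Poly_Mapping.keys v \<union> Poly_Mapping.keys w"
  show "lin_ext f (v + w) = lin_ext f v + lin_ext f w"
    using Poly_Mapping.keys_add[of v w]
    by (simp add: lin_ext_superset[of ?A] lookup_add scale_add_left sum.distrib)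
  have "Poly_Mapping.keys (scale c v) \<subseteq> Poly_Mapping.keys v"
    by (auto simp: in_keys_iff)
  then show "lin_ext f (scale c v) = scale c (lin_ext f v)"
    by (simp add: lin_ext_superset[of "Poly_Mapping.keys v"] scale_sum_right)
qed

lemma lin_ext_single [simp]: "lin_ext f (Poly_Mapping.single b c) = scale c (f b)"
  by (simp add: lin_ext_superset[of "{b}"])

lemma sum_scale_basis:
  "(\<Sum>b\<in>Poly_Mapping.keys v. scale (Poly_Mapping.lookup v b) (Poly_Mapping.single b 1)) = v"
proof (rule poly_mapping_eqI)
  fix a
  have "(\<Sum>b\<in>Poly_Mapping.keys v. Poly_Mapping.lookup v b * (1 when b = a))
    = (\<Sum>b\<in>Poly_Mapping.keys v. if b = a then Poly_Mapping.lookup v b else 0)"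
    by (intro sum.cong) (auto simp: when_def)
  then show "Poly_Mapping.lookup (\<Sum>b\<in>Poly_Mapping.keys v.
      scale (Poly_Mapping.lookup v b) (Poly_Mapping.single b 1)) a = Poly_Mapping.lookup v a"
    by (simp add: lookup_sum lookup_single when_def in_keys_iff)
qed

text \<open>Agreement is asked only on the support of \<open>v\<close>, because on
  \<open>Aq n\<close> and \<open>free_alg n\<close> it is known only at the admissible basis
  elements.\<close>

lemma klinear_eq_on_keys:
  fixes f g :: "('b \<Rightarrow>\<^sub>0 'k::field) \<Rightarrow> ('c \<Rightarrow>\<^sub>0 'k)"
  assumes "klinear f" and "klinear g"
    and "\<And>b. b \<in> Poly_Mapping.keys v \<Longrightarrow>
      f (Poly_Mapping.single b 1) = g (Poly_Mapping.single b 1)"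
  shows "f v = g v"
proof -
  have *: "h v = (\<Sum>b\<in>Poly_Mapping.keys v.
      scale (Poly_Mapping.lookup v b) (h (Poly_Mapping.single b 1)))" if "klinear h"
    for h :: "('b \<Rightarrow>\<^sub>0 'k) \<Rightarrow> ('c \<Rightarrow>\<^sub>0 'k)"
    by (subst (1) sum_scale_basis[of v, symmetric])
       (simp only: klinear_sum[OF that] klinear_scale[OF that])
  show ?thesis
    by (subst (1 2) *) (auto intro!: sum.cong simp: assms)
qed

lemma poly_mapping_add_induct [case_names single add]:
  fixes v :: "'b \<Rightarrow>\<^sub>0 'k::field"
  assumes "\<And>b c. P (Poly_Mapping.single b c)" and "\<And>u v. P u \<Longrightarrow> P v \<Longrightarrow> P (u + v)"
  shows "P v"
proof -
  have "P (\<Sum>b\<in>A. Poly_Mapping.single b (Poly_Mapping.lookup v b))" if "finite A" for A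
    using that
  proof induction
    case empty
    \<comment> \<open>The empty sum is a monomial with coefficient 0, so the induction rule has no
      separate case for zero.\<close>
    show ?case using assms(1)[of undefined 0] by simp
  qed (simp add: assms)
  from this[of "Poly_Mapping.keys v"] show ?thesis
    using sum_scale_basis[of v] by simp
qed

text \<open>A linear representation of a monoid extends to its monoid algebra. It serves both for
  words, giving the free algebra, and for pairs of words, giving its tensor square.\<close>

lemma lin_ext_mult:
  fixes \<rho> :: "'m::monoid_add \<Rightarrow> ('b \<Rightarrow>\<^sub>0 'k::field) \<Rightarrow> ('b \<Rightarrow>\<^sub>0 'k)"
  assumes lin: "\<And>a. klinear (\<rho> a)" and hom: "\<And>a b x. \<rho> (a + b) x = \<rho> a (\<rho> b x)"
  shows "lin_ext (\<lambda>w. \<rho> w x) (s * t) = lin_ext (\<lambda>w. \<rho> w (lin_ext (\<lambda>w. \<rho> w x) t)) s"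
proof (induction s rule: poly_mapping_add_induct)
  case (single a c)
  show ?case
  proof (induction t rule: poly_mapping_add_induct)
    case (single b d)
    then show ?case by (simp add: mult_single hom klinear_scale[OF lin])
  next
    case (add u v)
    then show ?case
      by (simp add: distrib_left klinear_add[OF klinear_lin_ext] klinear_add[OF lin] scale_add_right)
  qed
next
  case (add u v)
  then show ?case
    by (simp add: distrib_right klinear_add[OF klinear_lin_ext])
qed

lemma klinear_lin_ext_param:
  assumes "\<And>a. klinear (\<lambda>x. \<rho> a x)"
  shows "klinear (\<lambda>x. lin_ext (\<lambda>w. \<rho> w x) s)"
  by (simp add: klinear_iff lin_ext_def klinear_add[OF assms] klinear_scale[OF assms]
      scale_add_right sum.distrib scale_sum_right mult.commute)

section \<open>Tensor products\<close>

text \<open>Written as a nested linear extension, the tensor is visibly linear in each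
  argument.\<close>

lemma tensor_eq_lin_ext:
  "tensor v w = lin_ext (\<lambda>b. lin_ext (\<lambda>c. Poly_Mapping.single (b, c) 1) w) v"
  by (simp add: tensor_def lin_ext_def scale_sum_right)

lemma klinear_tensor_left: "klinear (\<lambda>v. tensor v w)"
  unfolding tensor_eq_lin_ext by (rule klinear_lin_ext)

lemma klinear_tensor_right: "klinear (tensor v)"
  unfolding tensor_eq_lin_ext by (rule klinear_lin_ext_param) (rule klinear_lin_ext)

lemma tensor_single [simp]:
  "tensor (Poly_Mapping.single b c) (Poly_Mapping.single b' c') = Poly_Mapping.single (b, b') (c * c')"
  by (simp add: tensor_eq_lin_ext)

lemma tensor_zero [simp]: "tensor 0 w = 0" "tensor v 0 = 0"
  by (simp_all add: tensor_def)

lemma tensor_scale [simp]: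
  "tensor (scale c v) w = scale c (tensor v w)" "tensor v (scale c w) = scale c (tensor v w)"
  by (simp_all add: klinear_scale[OF klinear_tensor_left] klinear_scale[OF klinear_tensor_right])

lemma klinear_tensor_map: "klinear (tensor_map S T)"
  unfolding tensor_map_def by (rule klinear_lin_ext)

lemma tensor_map_tensor:
  assumes S: "klinear S" and T: "klinear T"
  shows "tensor_map S T (tensor v w) = tensor (S v) (T w)"
proof (rule klinear_eq_on_keys[where v = v])
  show "klinear (\<lambda>v. tensor_map S T (tensor v w))"
    by (intro klinear_comp[OF klinear_tensor_map] klinear_tensor_left)
  show "klinear (\<lambda>v. tensor (S v) (T w))"
    by (rule klinear_comp[OF klinear_tensor_left S])
  fix b
  show "tensor_map S T (tensor (Poly_Mapping.single b 1) w) = tensor (S (Poly_Mapping.single b 1)) (T w)"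
  proof (rule klinear_eq_on_keys[where v = w])
    show "klinear (\<lambda>w. tensor_map S T (tensor (Poly_Mapping.single b 1) w))"
      by (intro klinear_comp[OF klinear_tensor_map] klinear_tensor_right)
    show "klinear (\<lambda>w. tensor (S (Poly_Mapping.single b 1)) (T w))"
      by (rule klinear_comp[OF klinear_tensor_right T])
  qed (simp add: tensor_map_def)
qed

text \<open>The inner maps enter only through their values on basis vectors; linearity of
  \<open>S\<close> and \<open>T\<close> then carries the outer map past a general tensor.\<close>

lemma tensor_map_comp:
  fixes S S' :: "('b \<Rightarrow>\<^sub>0 'k::field) \<Rightarrow> ('b \<Rightarrow>\<^sub>0 'k)" and T T' :: "('c \<Rightarrow>\<^sub>0 'k) \<Rightarrow> ('c \<Rightarrow>\<^sub>0 'k)"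
  assumes "klinear S" "klinear T"
  shows "tensor_map (\<lambda>v. S (S' v)) (\<lambda>w. T (T' w)) x = tensor_map S T (tensor_map S' T' x)"
proof (rule klinear_eq_on_keys[where v = x])
  fix bc :: "'b \<times> 'c"
  obtain b c where "bc = (b, c)" by force
  then show "tensor_map (\<lambda>v. S (S' v)) (\<lambda>w. T (T' w)) (Poly_Mapping.single bc 1)
      = tensor_map S T (tensor_map S' T' (Poly_Mapping.single bc 1))"
    using tensor_map_tensor[OF assms] by (simp add: tensor_map_def)
qed (auto intro: klinear_tensor_map klinear_comp[OF klinear_tensor_map])

lemma tensor_map_id: "tensor_map (\<lambda>v. v) (\<lambda>w. w) x = x"
  by (rule klinear_eq_on_keys[where v = x and g = "\<lambda>x. x", OF klinear_tensor_map])
     (auto simp: klinear_iff tensor_map_def)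

section \<open>Actions of rings and of their quotients\<close>

text \<open>A module reduced to what makes the annihilator an ideal: \<open>act_zero_right\<close>
  gives closure under multiplication from the left, \<open>act_closed\<close> under multiplication
  from the right.\<close>

locale ring_action = ring R for R :: "'r ring" (structure) +
  fixes M :: "'v::ab_group_add set" and act :: "'r \<Rightarrow> 'v \<Rightarrow> 'v"
  assumes act_add: "\<And>r s x. \<lbrakk>r \<in> carrier R; s \<in> carrier R; x \<in> M\<rbrakk> \<Longrightarrow> act (r \<oplus> s) x = act r x + act s x"
    and act_mult: "\<And>r s x. \<lbrakk>r \<in> carrier R; s \<in> carrier R; x \<in> M\<rbrakk> \<Longrightarrow> act (r \<otimes> s) x = act r (act s x)"
    and act_one: "\<And>x. x \<in> M \<Longrightarrow> act \<one> x = x"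
    and act_closed: "\<And>r x. \<lbrakk>r \<in> carrier R; x \<in> M\<rbrakk> \<Longrightarrow> act r x \<in> M"
    and act_zero_right: "\<And>r. r \<in> carrier R \<Longrightarrow> act r 0 = 0"
begin

definition annihilator :: "'r set" where
  "annihilator = {r \<in> carrier R. \<forall>x\<in>M. act r x = 0}"

lemma act_zero_left: "x \<in> M \<Longrightarrow> act \<zero> x = 0"
  using act_add[of \<zero> \<zero> x] by simp

lemma act_uminus:
  assumes "r \<in> carrier R" "x \<in> M"
  shows "act (\<ominus> r) x = - act r x"
proof -
  have "act r x + act (\<ominus> r) x = 0"
    using act_add[of r "\<ominus> r" x] assms by (simp add: r_neg act_zero_left)
  then show ?thesis
    by (simp add: add_eq_0_iff)
qed

lemma act_diff:
  assumes "r \<in> carrier R" "s \<in> carrier R" "x \<in> M"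
  shows "act (r \<ominus> s) x = act r x - act s x"
  using assms by (simp add: minus_eq act_add act_uminus)

lemma act_pow:
  assumes "r \<in> carrier R" "x \<in> M"
  shows "act (r [^] (k::nat)) x = (act r ^^ k) x"
  using assms(2)
proof (induction k arbitrary: x)
  case (Suc k)
  then show ?case
    using assms(1) by (simp add: act_mult act_closed funpow_swap1)
qed (simp add: act_one)

lemma ideal_annihilator: "ideal annihilator R"
proof (intro idealI ring_axioms group.subgroupI abelian_group.a_group is_abelian_group)
  show "annihilator \<subseteq> carrier (add_monoid R)"
    by (auto simp: annihilator_def)
  show "annihilator \<noteq> {}"
    using act_zero_left by (auto simp: annihilator_def)
  show "inv\<^bsub>add_monoid R\<^esub> a \<in> annihilator" if "a \<in> annihilator" for a
    using that act_uminus unfolding a_inv_def[symmetric] by (auto simp: annihilator_def)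
  show "a \<otimes>\<^bsub>add_monoid R\<^esub> b \<in> annihilator" if "a \<in> annihilator" "b \<in> annihilator" for a b
    using that by (auto simp: annihilator_def act_add)
  show "x \<otimes> a \<in> annihilator" if "a \<in> annihilator" "x \<in> carrier R" for a x
    using that by (auto simp: annihilator_def act_mult act_zero_right)
  show "a \<otimes> x \<in> annihilator" if "a \<in> annihilator" "x \<in> carrier R" for a x
    using that by (auto simp: annihilator_def act_mult act_closed)
qed

lemma act_coset_image:
  assumes "ideal I R" "I \<subseteq> annihilator" "r \<in> carrier R" "x \<in> M" "u \<in> I +> r"
  shows "u \<in> carrier R" and "act u x = act r x"
proof -
  obtain i where i: "i \<in> I" "u = i \<oplus> r"
    using assms(5) by (auto simp: a_r_coset_def')
  then have "i \<in> carrier R" "act i x = 0"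
    using assms by (auto simp: annihilator_def)
  with i assms show "u \<in> carrier R" and "act u x = act r x"
    by (auto simp: act_add)
qed

lemma self_mem_coset:
  assumes "ideal I R" "r \<in> carrier R"
  shows "r \<in> I +> r"
  unfolding a_r_coset_def'
  by (rule UN_I[OF additive_subgroup.zero_closed[OF ideal.axioms(1)[OF assms(1)]]])
     (simp add: assms(2))

text \<open>\<open>the_elem\<close> is meaningful only on a singleton: the image of the coset is
  constant because \<open>I\<close> kills \<open>M\<close>, and inhabited because \<open>r\<close>
  is a representative.\<close>

lemma quot_act_coset:
  assumes "ideal I R" "I \<subseteq> annihilator" "r \<in> carrier R" "x \<in> M"
  shows "quot_act act (I +> r) x = act r x"
proof -
  have "(\<lambda>u. act u x) ` (I +> r) = (\<lambda>u. act r x) ` (I +> r)"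
    by (rule image_cong[OF refl act_coset_image(2)[OF assms]])
  also have "\<dots> = {act r x}"
    by (rule image_constant[OF self_mem_coset[OF assms(1,3)]])
  finally show ?thesis
    by (simp add: quot_act_def)
qed

lemma carrier_Quot: "carrier (R Quot I) = (\<lambda>r. I +> r) ` carrier R"
  by (auto simp: FactRing_def A_RCOSETS_def')

text \<open>The result is again an instance of the locale, so the annihilator argument can be
  repeated for a quotient of a quotient.\<close>

lemma ring_action_Quot:
  assumes I: "ideal I R" and ann: "I \<subseteq> annihilator" and zero: "0 \<in> M"
  shows "ring_action (R Quot I) M (quot_act act)"
proof -
  interpret I: ideal I R by fact
  note qc = quot_act_coset[OF I ann]
  interpret Q: ring "R Quot I" by (rule I.quotient_is_ring)
  show ?thesis
  proof
    fix C D x assume C: "C \<in> carrier (R Quot I)" and D: "D \<in> carrier (R Quot I)" and x: "x \<in> M"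
    obtain c d where *: "C = I +> c" "D = I +> d" "c \<in> carrier R" "d \<in> carrier R"
      using C D by (auto simp: carrier_Quot)
    show "quot_act act (C \<oplus>\<^bsub>R Quot I\<^esub> D) x = quot_act act C x + quot_act act D x"
      using * x by (simp add: FactRing_def I.a_rcos_sum qc act_add)
    show "quot_act act (C \<otimes>\<^bsub>R Quot I\<^esub> D) x = quot_act act C (quot_act act D x)"
      using * x by (simp add: FactRing_def I.rcoset_mult_add qc act_mult act_closed)
  next
    fix C x assume C: "C \<in> carrier (R Quot I)" and x: "x \<in> M"
    then show "quot_act act C x \<in> M"
      by (auto simp: carrier_Quot qc act_closed)
  next
    fix C assume "C \<in> carrier (R Quot I)"
    then show "quot_act act C 0 = 0"
      by (auto simp: carrier_Quot qc act_zero_right zero)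
  next
    fix x assume "x \<in> M"
    then show "quot_act act \<one>\<^bsub>R Quot I\<^esub> x = x"
      by (simp add: FactRing_def qc act_one)
  qed
qed

text \<open>The second action need not descend to the quotient on the whole target: on the image of
  \<open>d\<close> its values are images of values of the first one.\<close>

lemma quot_act_intertwine:
  assumes I: "ideal I R" "I \<subseteq> annihilator" and C: "C \<in> carrier (R Quot I)" and x: "x \<in> M"
    and d: "\<And>r. r \<in> carrier R \<Longrightarrow> d (act r x) = act' r (d x)"
  shows "d (quot_act act C x) = quot_act act' C (d x)"
proof -
  obtain r where r: "C = I +> r" "r \<in> carrier R"
    using C by (auto simp: carrier_Quot)
  have "(\<lambda>u. act' u (d x)) ` C = (\<lambda>u. d (act r x)) ` C"
  proof (rule image_cong[OF refl])
    fix u assume "u \<in> C"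
    then have "u \<in> carrier R" "act u x = act r x"
      using act_coset_image[OF I r(2) x, of u] r(1) by simp_all
    then show "act' u (d x) = d (act r x)"
      using d[of u] by simp
  qed
  also have "\<dots> = {d (act r x)}"
    using self_mem_coset[OF I(1) r(2)] r(1) by (intro image_constant[of r]) simp
  finally show ?thesis
    using quot_act_coset[OF I r(2) x] r by (simp add: quot_act_def)
qed

end

section \<open>Actions of the free algebra\<close>

lemma word_act_add: "word_act op (v + w) x = word_act op v (word_act op w x)"
  by (simp add: word_act_def plus_free_monoid_def)

lemma word_act_zero [simp]: "word_act op 0 = (\<lambda>x. x)"
  by (simp add: word_act_def zero_free_monoid_def fun_eq_iff)

lemma word_act_Cons: "word_act op (Word (g # w)) x = op g (word_act op (Word w) x)"
  by (simp add: word_act_def)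

lemma word_act_gen [simp]: "word_act op (Word [g]) = op g"
  by (simp add: word_act_def fun_eq_iff)

lemma klinear_word_act:
  assumes "\<And>g. klinear (op g)"
  shows "klinear (word_act op w)"
proof -
  have "klinear (foldr op gs)" for gs
    by (induction gs) (use assms in \<open>auto simp: klinear_iff\<close>)
  then show ?thesis
    by (simp add: word_act_def)
qed

lemma falg_act_eq_lin_ext: "falg_act op u x = lin_ext (\<lambda>w. word_act op w x) u"
  by (simp add: falg_act_def lin_ext_def)

lemma klinear_falg_act_left: "klinear (\<lambda>u. falg_act op u x)"
  unfolding falg_act_eq_lin_ext by (rule klinear_lin_ext)

lemma falg_act_gen: "falg_act op (falg_gen g) x = op g x"
  by (simp add: falg_act_eq_lin_ext falg_gen_def)

lemma falg_act_one: "falg_act op 1 x = x"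
  unfolding single_one[symmetric] by (simp add: falg_act_eq_lin_ext del: single_one)

lemma falg2_act_eq_lin_ext:
  "falg2_act op op' t y = lin_ext (\<lambda>w. tensor_map (word_act op (fst w)) (word_act op' (snd w)) y) t"
  by (simp add: falg2_act_def lin_ext_def)

lemma klinear_falg2_act_left: "klinear (\<lambda>t. falg2_act op op' t y)"
  unfolding falg2_act_eq_lin_ext by (rule klinear_lin_ext)

lemma falg2_act_one: "falg2_act op op' 1 y = y"
  unfolding single_one[symmetric] by (simp add: falg2_act_eq_lin_ext tensor_map_id del: single_one)

lemma falg2_act_tensor_word:
  "falg2_act op op' (tensor (Poly_Mapping.single v 1) (Poly_Mapping.single w 1)) y
    = tensor_map (word_act op v) (word_act op' w) y"
  by (simp add: falg2_act_eq_lin_ext)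

context
  fixes op :: "gen \<Rightarrow> ('b \<Rightarrow>\<^sub>0 'k::field) \<Rightarrow> ('b \<Rightarrow>\<^sub>0 'k)"
  assumes op: "\<And>g. klinear (op g)"
begin

lemma klinear_falg_act: "klinear (falg_act op u)"
  unfolding falg_act_eq_lin_ext by (rule klinear_lin_ext_param) (rule klinear_word_act[OF op])

lemma falg_act_mult: "falg_act op (u * v) x = falg_act op u (falg_act op v x)"
  unfolding falg_act_eq_lin_ext by (rule lin_ext_mult) (simp_all add: klinear_word_act[OF op] word_act_add)

context
  fixes op' :: "gen \<Rightarrow> ('c \<Rightarrow>\<^sub>0 'k) \<Rightarrow> ('c \<Rightarrow>\<^sub>0 'k)"
  assumes op': "\<And>g. klinear (op' g)"
begin

lemma klinear_falg2_act: "klinear (falg2_act op op' t)"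
  unfolding falg2_act_eq_lin_ext by (rule klinear_lin_ext_param) (rule klinear_tensor_map)

text \<open>Addition of pairs of words is concatenation in each component, so the claim reduces to
  the interchange law for compositions of tensor maps.\<close>

lemma falg2_act_mult: "falg2_act op op' (s * t) y = falg2_act op op' s (falg2_act op op' t y)"
  unfolding falg2_act_eq_lin_ext
proof (rule lin_ext_mult)
  fix v w :: "gen free_monoid \<times> gen free_monoid" and y :: "'b \<times> 'c \<Rightarrow>\<^sub>0 'k"
  have "word_act op (fst (v + w)) = (\<lambda>x. word_act op (fst v) (word_act op (fst w) x))"
    "word_act op' (snd (v + w)) = (\<lambda>x. word_act op' (snd v) (word_act op' (snd w) x))"
    by (simp_all add: word_act_add fun_eq_iff)
  then show "tensor_map (word_act op (fst (v + w))) (word_act op' (snd (v + w))) y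
    = tensor_map (word_act op (fst v)) (word_act op' (snd v))
        (tensor_map (word_act op (fst w)) (word_act op' (snd w)) y)"
    by (simp only: tensor_map_comp klinear_word_act[OF op] klinear_word_act[OF op'])
qed (rule klinear_tensor_map)

text \<open>Both \<open>comult\<close> and \<open>falg2_act\<close> turn concatenation of words into
  composition of operators; linearity in \<open>u\<close> and induction on words leave only the
  generators.\<close>

lemma falg_tensor_act_intertwine:
  assumes d: "klinear d" and M: "\<And>g x. \<lbrakk>gen_index g \<in> {1..n-1}; x \<in> M\<rbrakk> \<Longrightarrow> op g x \<in> M"
    and dg: "\<And>g x. \<lbrakk>gen_index g \<in> {1..n-1}; x \<in> M\<rbrakk>
      \<Longrightarrow> d (op g x) = falg2_act op op' (comult_gen g) (d x)"
    and u: "u \<in> carrier (free_alg n)" and x: "x \<in> M"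
  shows "d (falg_act op u x) = falg_tensor_act op op' u (d x)"
proof (rule klinear_eq_on_keys[where v = u])
  show "klinear (\<lambda>u. d (falg_act op u x))"
    by (rule klinear_comp[OF d klinear_falg_act_left])
  show "klinear (\<lambda>u. falg_tensor_act op op' u (d x))"
    unfolding falg_tensor_act_def comult_def
    by (rule klinear_comp[OF klinear_falg2_act_left klinear_lin_ext])
  fix w assume "w \<in> Poly_Mapping.keys u"
  then have "\<forall>g\<in>set (letters w). gen_index g \<in> {1..n-1}"
    using u by (simp add: free_alg_def)
  \<comment> \<open>Membership in \<open>M\<close> travels through the induction because
    \<open>dg\<close> is available only there.\<close>
  moreover have "word_act op (Word gs) x \<in> M \<and>
      d (word_act op (Word gs) x) = falg2_act op op' (prod_list (map comult_gen gs)) (d x)"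
    if "\<forall>g\<in>set gs. gen_index g \<in> {1..n-1}" for gs
    using that
  proof (induction gs)
    case Nil
    then show ?case
      using x by (simp add: falg2_act_one zero_free_monoid_def[symmetric])
  next
    case (Cons g gs)
    then show ?case
      by (simp add: word_act_Cons M dg falg2_act_mult)
  qed
  ultimately have "d (word_act op w x)
      = falg2_act op op' (prod_list (map comult_gen (letters w))) (d x)"
    by (metis free_monoid.collapse)
  then show "d (falg_act op (Poly_Mapping.single w 1) x)
      = falg_tensor_act op op' (Poly_Mapping.single w 1) (d x)"
    by (simp add: falg_act_eq_lin_ext falg_tensor_act_def comult_def)
qed

end

end

section \<open>Quantum integers\<close>

lemma qint_zero [simp]: "qint q 0 = 0"
  by (simp add: qint_def)

context
  fixes q :: "'k::field"
  assumes q0: "q \<noteq> 0" and q1: "q \<noteq> 1" and qm1: "q \<noteq> -1"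
begin

lemma q_minus_inverse_nonzero: "q - inverse q \<noteq> 0"
proof
  assume "q - inverse q = 0"
  then have "(q - 1) * (q + 1) = 0"
    using q0 by (simp add: field_simps)
  then show False
    using q1 qm1 by (simp add: eq_neg_iff_add_eq_0)
qed

lemma qint_add_one: "qint q (a + 1) = q * qint q a + q powi (- a)"
  and qint_add_one': "q * qint q (a + 1) = qint q a + q powi (a + 1)"
  and qint_rec: "qint q (a + 2) + qint q a = (q + inverse q) * qint q (a + 1)"
proof -
  \<comment> \<open>The powers q^a and q^(-a) become independent symbols: all three identities are
    linear in them and hold without xy = 1.\<close>
  define x y where "x = q powi a" and "y = q powi (- a)"
  have p: "q powi (a + 1) = q * x" "q powi (- (a + 1)) = y / q"
    "q powi (a + 2) = q * q * x" "q powi (- (a + 2)) = y / (q * q)"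
    using q0 by (simp_all add: x_def y_def power_int_add power_int_diff power2_eq_square
        power_int_minus field_simps)
  have u: "qint q a = (x - y) / (q - inverse q)"
    "qint q (a + 1) = (q * x - y / q) / (q - inverse q)"
    "qint q (a + 2) = (q * q * x - y / (q * q)) / (q - inverse q)"
    unfolding qint_def p x_def[symmetric] y_def[symmetric] by (rule refl)+
  note nz = q_minus_inverse_nonzero
  have "(q - inverse q) * qint q (a + 1) = (q - inverse q) * (q * qint q a + y)"
    using nz q0 unfolding u by (simp add: distrib_left) (simp add: field_simps)
  with nz show "qint q (a + 1) = q * qint q a + q powi (- a)"
    by (simp add: y_def)
  have "(q - inverse q) * (q * qint q (a + 1)) = (q - inverse q) * (qint q a + q * x)"
    using nz q0 unfolding u by (simp add: distrib_left) (simp add: field_simps)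
  with nz show "q * qint q (a + 1) = qint q a + q powi (a + 1)"
    by (simp add: p)
  have "(q - inverse q) * (qint q (a + 2) + qint q a)
      = (q - inverse q) * ((q + inverse q) * qint q (a + 1))"
    using nz q0 unfolding u by (simp add: distrib_left) (simp add: field_simps)
  with nz show "qint q (a + 2) + qint q a = (q + inverse q) * qint q (a + 1)"
    by simp
qed

text \<open>This is [a][b+1] - [a+1][b] = [a-b], with the right-hand side spelled out to match the
  relation between e_i, f_i and K_i.\<close>

lemma qint_commutator:
  "qint q a * qint q (b + 1) - qint q (a + 1) * qint q b
    = inverse (q - inverse q) * (q powi (a - b) - q powi (- (a - b)))"
proof -
  define x y where "x = q powi a" and "y = q powi b"
  have xy: "x \<noteq> 0" "y \<noteq> 0"
    using q0 by (simp_all add: x_def y_def)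
  have p: "q powi (- a) = inverse x" "q powi (- b) = inverse y"
    "q powi (a + 1) = q * x" "q powi (b + 1) = q * y"
    "q powi (- (a + 1)) = inverse (q * x)" "q powi (- (b + 1)) = inverse (q * y)"
    "q powi (a - b) = x / y" "q powi (- (a - b)) = y / x"
    using q0 by (simp_all add: x_def y_def power_int_add power_int_diff power_int_minus field_simps)
  define D where "D = q - inverse q"
  have D: "D \<noteq> 0" using q_minus_inverse_nonzero by (simp add: D_def)
  have "(x - inverse x) * (q * y - inverse (q * y)) - (q * x - inverse (q * x)) * (y - inverse y)
      = D * (x / y - y / x)"
    using q0 xy by (simp add: D_def field_simps)
  moreover have div: "A / D * (B / D) - C / D * (E / D) = inverse D * F"
    if "A * B - C * E = D * F" for A B C E F
  proof -
    have "A / D * (B / D) - C / D * (E / D) = (A * B - C * E) / (D * D)"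
      by (simp add: diff_divide_distrib)
    with that D show ?thesis
      by (simp add: field_simps)
  qed
  ultimately have "(x - inverse x) / D * ((q * y - inverse (q * y)) / D)
      - (q * x - inverse (q * x)) / D * ((y - inverse y) / D) = inverse D * (x / y - y / x)"
    by (intro div)
  then show ?thesis
    unfolding qint_def p x_def[symmetric] y_def[symmetric] D_def .
qed

text \<open>A condition on powers of \<open>q\<close> is evidently inherited by multiples, so one
  zero of the quantum integers yields all multiples of \<open>l\<close>.\<close>

lemma qint_eq_zero_iff: "qint q a = 0 \<longleftrightarrow> q powi (2 * a) = 1"
proof -
  have "qint q a = 0 \<longleftrightarrow> q powi a = inverse (q powi a)"
    using q_minus_inverse_nonzero by (simp add: qint_def power_int_minus)
  also have "\<dots> \<longleftrightarrow> q powi a * q powi a = 1"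
    using q0 by (simp add: field_simps)
  also have "q powi a * q powi a = q powi (2 * a)"
    using q0 by (simp add: power_int_add[symmetric])
  finally show ?thesis .
qed

end

text \<open>Positivity of \<open>l\<close> excludes the default value 0 of \<open>qchar\<close>, so
  the least root exists.\<close>

lemma qint_qchar:
  assumes "qchar q = l" and "0 < l"
  shows "qint q (int l) = 0"
proof -
  have "\<exists>l>0. qint q (int l) = 0"
    using assms by (auto simp: qchar_def split: if_splits)
  then show ?thesis
    using assms LeastI_ex[of "\<lambda>l. 0 < l \<and> qint q (int l) = 0"] by (auto simp: qchar_def)
qed

lemma power_int_qchar:
  fixes q :: "'k::field"
  assumes "q \<noteq> 0" "q \<noteq> 1" "q \<noteq> -1" "qchar q = l" "0 < l"
  shows "q powi (2 * (int l * m)) = 1"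
proof -
  have "q powi (2 * int l) = 1"
    using qint_qchar[OF assms(4,5)] qint_eq_zero_iff[OF assms(1-3)] by simp
  then have "(q powi (2 * int l)) powi m = 1" by simp
  then show ?thesis
    by (simp add: power_int_mult[symmetric] mult.assoc)
qed

section \<open>The quantum divided power algebra\<close>

lemma klinear_Aq_op: "klinear (Aq_op q n g)"
  unfolding Aq_op_def by (rule klinear_lin_ext)

lemma klinear_Lambda1_op: "klinear (Lambda1_op q g)"
  unfolding Lambda1_op_def by (rule klinear_lin_ext)

lemma zero_mem_Aq: "0 \<in> Aq n"
  by (simp add: Aq_def)

lemma xpow_mem_Aq: "xpow n \<beta> \<in> Aq n"
  by (auto simp: Aq_def xpow_def)

lemma scale_mem_Aq: "x \<in> Aq n \<Longrightarrow> scale c x \<in> Aq n"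
  by (fastforce simp: Aq_def in_keys_iff)

lemma sum_mem_Aq: "(\<And>a. a \<in> A \<Longrightarrow> f a \<in> Aq n) \<Longrightarrow> sum f A \<in> Aq n"
  using keys_sum[of f A] by (fastforce simp: Aq_def)

lemma Aq_op_mem_Aq: "Aq_op q n g x \<in> Aq n"
proof -
  have "Aq_gen_basis q n g \<beta> \<in> Aq n" for \<beta>
    by (cases g) (simp_all add: scale_mem_Aq xpow_mem_Aq)
  then show ?thesis
    by (simp add: Aq_op_def lin_ext_def sum_mem_Aq scale_mem_Aq)
qed

lemma falg_act_Aq_op_mem_Aq:
  assumes "x \<in> Aq n"
  shows "falg_act (Aq_op q n) u x \<in> Aq n"
proof -
  \<comment> \<open>Each operator has its whole image in \<open>Aq n\<close>; the assumption on
    \<open>x\<close> serves the empty word.\<close>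
  have "foldr (Aq_op q n) gs x \<in> Aq n" for gs
    using assms by (cases gs) (simp_all add: Aq_op_mem_Aq)
  then show ?thesis
    by (simp add: falg_act_def word_act_def sum_mem_Aq scale_mem_Aq)
qed

text \<open>For \<beta> outside \<open>Zplus n\<close> the last premise reads
  \<open>f 0 = g 0\<close>. Letting \<beta> range over all exponents matches the unrestricted
  formulas, so later computations carry no membership conditions.\<close>

lemma klinear_eq_on_Aq:
  fixes f g :: "((nat \<Rightarrow> int) \<Rightarrow>\<^sub>0 'k::field) \<Rightarrow> ('c \<Rightarrow>\<^sub>0 'k)"
  assumes "klinear f" and "klinear g" and "x \<in> Aq n" and "\<And>\<beta>. f (xpow n \<beta>) = g (xpow n \<beta>)"
  shows "f x = g x"
proof (rule klinear_eq_on_keys[OF assms(1,2)])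
  fix \<beta> assume "\<beta> \<in> Poly_Mapping.keys x"
  then show "f (Poly_Mapping.single \<beta> 1) = g (Poly_Mapping.single \<beta> 1)"
    using assms(3) assms(4)[of \<beta>] by (auto simp: Aq_def xpow_def)
qed

text \<open>The formulas for the action hold for all exponents in \<open>\<int>\<^sup>n\<close>: an operator leads from outside
  \<open>\<int>\<^sub>+\<^sup>n\<close> into it only when the exponent that grows is \<open>-1\<close>, and then the coefficient is \<open>[0] = 0\<close>.\<close>

lemma Aq_op_xpow:
  assumes "i \<in> {1..n-1}"
  shows Aq_op_E_xpow: "Aq_op q n (GenE i) (xpow n \<beta>)
      = scale (qint q (\<beta> i + 1)) (xpow n (\<beta> + eps i - eps (i+1)))"
    and Aq_op_F_xpow: "Aq_op q n (GenF i) (xpow n \<beta>)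
      = scale (qint q (\<beta> (i+1) + 1)) (xpow n (\<beta> - eps i + eps (i+1)))"
    and Aq_op_K_xpow: "Aq_op q n (GenK i) (xpow n \<beta>)
      = scale (q powi (\<beta> i - \<beta> (i+1))) (xpow n \<beta>)"
    and Aq_op_Kinv_xpow: "Aq_op q n (GenKinv i) (xpow n \<beta>)
      = scale (q powi (- (\<beta> i - \<beta> (i+1)))) (xpow n \<beta>)"
proof -
  have zero: "Aq_op q n g (xpow n \<beta>) = 0" if "\<beta> \<notin> Zplus n" for g
    using that by (simp add: xpow_def klinear_zero[OF klinear_Aq_op])
  have basis: "Aq_op q n g (xpow n \<beta>) = Aq_gen_basis q n g \<beta>" if "\<beta> \<in> Zplus n" for g
    using that by (simp add: xpow_def Aq_op_def)
  \<comment> \<open>A unit moves from entry \<open>m\<close> to entry \<open>k\<close>. Both lie in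
    range, so \<beta> vanishes off \<open>{1..n}\<close> and must have a negative entry, which only
    \<open>eps k\<close> can repair, and only from -1.\<close>
  have neg: "\<beta> k = -1" if "\<beta> \<notin> Zplus n" and \<gamma>: "\<beta> + eps k - eps m \<in> Zplus n"
    and "k \<in> {1..n}" "m \<in> {1..n}" for k m
  proof -
    have *: "\<And>j. j \<in> {1..n} \<Longrightarrow> 0 \<le> \<beta> j + eps k j - eps m j"
      "\<And>j. j \<notin> {1..n} \<Longrightarrow> \<beta> j + eps k j - eps m j = 0"
      using \<gamma> by (auto simp: Zplus_def)
    have "\<beta> j = 0" if "j \<notin> {1..n}" for j
      using *(2)[OF that] that \<open>k \<in> _\<close> \<open>m \<in> _\<close> by (auto simp: eps_def split: if_splits)
    then obtain j where "j \<in> {1..n}" "\<beta> j < 0"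
      using \<open>\<beta> \<notin> Zplus n\<close> by (force simp: Zplus_def)
    with *(1)[of j] show ?thesis
      by (auto simp: eps_def split: if_splits)
  qed
  show "Aq_op q n (GenE i) (xpow n \<beta>)
      = scale (qint q (\<beta> i + 1)) (xpow n (\<beta> + eps i - eps (i+1)))"
  proof (cases "\<beta> \<in> Zplus n")
    case False
    then show ?thesis
      using neg[of i "i + 1"] assms by (auto simp: xpow_def klinear_zero[OF klinear_Aq_op])
  qed (simp add: basis)
  show "Aq_op q n (GenF i) (xpow n \<beta>)
      = scale (qint q (\<beta> (i+1) + 1)) (xpow n (\<beta> - eps i + eps (i+1)))"
  proof (cases "\<beta> \<in> Zplus n")
    case False
    moreover have comm: "\<beta> - eps i + eps (i+1) = \<beta> + eps (i+1) - eps i"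
      by simp
    ultimately show ?thesis
      using neg[of "i + 1" i] assms unfolding comm by (auto simp: xpow_def klinear_zero[OF klinear_Aq_op])
  qed (simp add: basis)
  show "Aq_op q n (GenK i) (xpow n \<beta>) = scale (q powi (\<beta> i - \<beta> (i+1))) (xpow n \<beta>)"
    by (cases "\<beta> \<in> Zplus n") (simp_all add: basis zero, simp add: xpow_def)
  show "Aq_op q n (GenKinv i) (xpow n \<beta>) = scale (q powi (- (\<beta> i - \<beta> (i+1)))) (xpow n \<beta>)"
    by (cases "\<beta> \<in> Zplus n") (simp_all add: basis zero, simp add: xpow_def)
qed

lemma eps_apply: "eps i j = of_bool (i = j)"
  by (simp add: eps_def)

section \<open>The free algebra: its action on A_q(n) and closure properties\<close>

lemma ring_action_Aq: "ring_action (free_alg n) (Aq n) (falg_act (Aq_op q n))"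
proof -
  interpret ring "free_alg n" by (rule ring_free_alg)
  show ?thesis
    by unfold_locales
       (simp_all add: free_alg_def klinear_add[OF klinear_falg_act_left] falg_act_mult klinear_Aq_op
         falg_act_one falg_act_Aq_op_mem_Aq klinear_zero[OF klinear_falg_act])
qed

lemma free_alg_closed:
  assumes "u \<in> carrier (free_alg n)"
  shows free_alg_scale_closed: "scale c u \<in> carrier (free_alg n)"
    and free_alg_add_closed: "v \<in> carrier (free_alg n) \<Longrightarrow> u + v \<in> carrier (free_alg n)"
    and free_alg_mult_closed: "v \<in> carrier (free_alg n) \<Longrightarrow> u * v \<in> carrier (free_alg n)"
    and free_alg_diff_closed: "v \<in> carrier (free_alg n) \<Longrightarrow> u - v \<in> carrier (free_alg n)"
proof -
  interpret ring "free_alg n :: 'a falg ring" by (rule ring_free_alg)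
  show scale: "scale c u \<in> carrier (free_alg n)" for c
    using assms by (auto simp: free_alg_def in_keys_iff)
  show add: "u + v \<in> carrier (free_alg n)" if "v \<in> carrier (free_alg n)" for v
    using a_closed[OF assms that] by (simp add: free_alg_def)
  show "u * v \<in> carrier (free_alg n)" if "v \<in> carrier (free_alg n)"
    using m_closed[OF assms that] by (simp add: free_alg_def)
  show "u - v \<in> carrier (free_alg n)" if "v \<in> carrier (free_alg n)"
    using add[of "- v"] that by (simp add: free_alg_def)
qed

lemma free_alg_one_closed: "1 \<in> carrier (free_alg n)"
  using ring.ring_simprules(6)[OF ring_free_alg[of n]] by (simp add: free_alg_def)

lemma falg_gen_closed: "gen_index g \<in> {1..n-1} \<Longrightarrow> falg_gen g \<in> carrier (free_alg n)"
  by (simp add: free_alg_def falg_gen_def)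

lemma Uq_relations_closed: "Uq_relations q n \<subseteq> carrier (free_alg n)"
  unfolding Uq_relations_def Let_def
  by (safe; intro free_alg_closed free_alg_one_closed falg_gen_closed; simp)

section \<open>The defining relations of U_q(sl_n) on A_q(n)\<close>

context
  fixes q :: "'k::field" and n :: nat
  assumes q: "q \<noteq> 0" "q \<noteq> 1" "q \<noteq> -1"
begin

abbreviation "opE i \<equiv> Aq_op q n (GenE i)"
abbreviation "opF i \<equiv> Aq_op q n (GenF i)"
abbreviation "opK i \<equiv> Aq_op q n (GenK i)"
abbreviation "opKinv i \<equiv> Aq_op q n (GenKinv i)"

lemma opK_opKinv:
  assumes "i \<in> {1..n-1}"
  shows "opK i (opKinv i (xpow n \<beta>)) = xpow n \<beta>" "opKinv i (opK i (xpow n \<beta>)) = xpow n \<beta>"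
  using assms q by (simp_all add: Aq_op_xpow klinear_scale[OF klinear_Aq_op] power_int_add[symmetric])

lemma opK_opK:
  assumes "i \<in> {1..n-1}" "j \<in> {1..n-1}"
  shows "opK i (opK j (xpow n \<beta>)) = opK j (opK i (xpow n \<beta>))"
  using assms q by (simp add: Aq_op_xpow klinear_scale[OF klinear_Aq_op] mult.commute)

lemma opK_opE:
  assumes "i \<in> {1..n-1}" "j \<in> {1..n-1}"
  shows "opK i (opE j (opKinv i (xpow n \<beta>))) = scale (q powi cartan i j) (opE j (xpow n \<beta>))"
proof -
  \<comment> \<open>The operator e_j shifts the weight for K_i by the Cartan integer. Subtracting
    the exponent contributed by \<open>opKinv\<close> prepares the cancellation of the two
    powers.\<close>
  have "(\<beta> + eps j - eps (j+1)) i - (\<beta> + eps j - eps (j+1)) (i+1)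
      = cartan i j - (- (\<beta> i - \<beta> (i+1)))"
    by (simp add: eps_apply cartan_def)
  moreover have "q powi m * c * q powi (k - m) = q powi k * c" for m k c
    using q by (simp add: power_int_diff)
  ultimately show ?thesis
    using assms by (simp only: Aq_op_xpow klinear_scale[OF klinear_Aq_op] scale_scale)
qed

lemma opK_opF:
  assumes "i \<in> {1..n-1}" "j \<in> {1..n-1}"
  shows "opK i (opF j (opKinv i (xpow n \<beta>))) = scale (q powi (- cartan i j)) (opF j (xpow n \<beta>))"
proof -
  have "(\<beta> - eps j + eps (j+1)) i - (\<beta> - eps j + eps (j+1)) (i+1)
      = - cartan i j - (- (\<beta> i - \<beta> (i+1)))"
    by (simp add: eps_apply cartan_def)
  moreover have "q powi m * c * q powi (k - m) = q powi k * c" for m k c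
    using q by (simp add: power_int_diff)
  ultimately show ?thesis
    using assms by (simp only: Aq_op_xpow klinear_scale[OF klinear_Aq_op] scale_scale)
qed

lemma opE_opF_same:
  assumes "i \<in> {1..n-1}"
  shows "opE i (opF i (xpow n \<beta>)) - opF i (opE i (xpow n \<beta>))
    = scale (inverse (q - inverse q)) (opK i (xpow n \<beta>) - opKinv i (xpow n \<beta>))"
proof -
  have "opE i (opF i (xpow n \<beta>)) = scale (qint q (\<beta> i) * qint q (\<beta> (i+1) + 1)) (xpow n \<beta>)"
    "opF i (opE i (xpow n \<beta>)) = scale (qint q (\<beta> i + 1) * qint q (\<beta> (i+1))) (xpow n \<beta>)"
    using assms by (simp_all add: Aq_op_xpow klinear_scale[OF klinear_Aq_op] eps_apply mult.commute)
  then show ?thesis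
    using assms qint_commutator[OF q, of "\<beta> i" "\<beta> (i+1)"]
    by (simp only: Aq_op_xpow scale_diff_left[symmetric] scale_scale)
qed

text \<open>If i = j + 1, both operators raise the same entry b and either order gives [b+1][b+2];
  otherwise neither changes the entry from which the other takes its coefficient.\<close>

lemma opE_opF_distinct:
  assumes "i \<in> {1..n-1}" "j \<in> {1..n-1}" "i \<noteq> j"
  shows "opE i (opF j (xpow n \<beta>)) = opF j (opE i (xpow n \<beta>))"
proof -
  have "\<beta> - eps j + eps (j+1) + eps i - eps (i+1) = \<beta> + eps i - eps (i+1) - eps j + eps (j+1)"
    by (simp add: algebra_simps)
  moreover have "qint q (\<beta> (j+1) + 1) * qint q ((\<beta> - eps j + eps (j+1)) i + 1)
      = qint q (\<beta> i + 1) * qint q ((\<beta> + eps i - eps (i+1)) (j+1) + 1)"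
    using assms(3) by (auto simp: eps_apply mult.commute)
  ultimately show ?thesis
    using assms by (simp only: Aq_op_xpow klinear_scale[OF klinear_Aq_op] scale_scale)
qed

lemma opE_opE_commute:
  assumes "i \<in> {1..n-1}" "j \<in> {1..n-1}" "cartan i j = 0"
  shows "opE i (opE j (xpow n \<beta>)) = opE j (opE i (xpow n \<beta>))"
proof -
  have "\<beta> + eps j - eps (j+1) + eps i - eps (i+1) = \<beta> + eps i - eps (i+1) + eps j - eps (j+1)"
    by (simp add: algebra_simps)
  moreover have "qint q (\<beta> j + 1) * qint q ((\<beta> + eps j - eps (j+1)) i + 1)
      = qint q (\<beta> i + 1) * qint q ((\<beta> + eps i - eps (i+1)) j + 1)"
    using assms(3) by (auto simp: eps_apply mult.commute cartan_def split: if_splits)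
  ultimately show ?thesis
    using assms by (simp only: Aq_op_xpow klinear_scale[OF klinear_Aq_op] scale_scale)
qed

lemma opF_opF_commute:
  assumes "i \<in> {1..n-1}" "j \<in> {1..n-1}" "cartan i j = 0"
  shows "opF i (opF j (xpow n \<beta>)) = opF j (opF i (xpow n \<beta>))"
proof -
  have "\<beta> - eps j + eps (j+1) - eps i + eps (i+1) = \<beta> - eps i + eps (i+1) - eps j + eps (j+1)"
    by (simp add: algebra_simps)
  moreover have "qint q (\<beta> (j+1) + 1) * qint q ((\<beta> - eps j + eps (j+1)) (i+1) + 1)
      = qint q (\<beta> (i+1) + 1) * qint q ((\<beta> - eps i + eps (i+1)) (j+1) + 1)"
    using assms(3) by (auto simp: eps_apply mult.commute cartan_def split: if_splits)
  ultimately show ?thesis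
    using assms by (simp only: Aq_op_xpow klinear_scale[OF klinear_Aq_op] scale_scale)
qed

text \<open>All three words lead to the same exponent \<gamma>. Up to a common factor their
  coefficients are three consecutive quantum integers, whence the three-term recurrence.\<close>

lemma opE_serre:
  assumes "i \<in> {1..n-1}" "j \<in> {1..n-1}" "cartan i j = -1"
  shows "opE i (opE i (opE j (xpow n \<beta>))) + opE j (opE i (opE i (xpow n \<beta>)))
    = scale (q + inverse q) (opE i (opE j (opE i (xpow n \<beta>))))"
proof -
  define \<gamma> where "\<gamma> = \<beta> + eps j - eps (j+1) + eps i - eps (i+1) + eps i - eps (i+1)"
  have \<gamma>: "\<beta> + eps i - eps (i+1) + eps j - eps (j+1) + eps i - eps (i+1) = \<gamma>"
    "\<beta> + eps i - eps (i+1) + eps i - eps (i+1) + eps j - eps (j+1) = \<gamma>"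
    by (simp_all add: \<gamma>_def algebra_simps)
  have cases: "j = i + 1 \<or> i = j + 1"
    using assms(3) by (auto simp: cartan_def split: if_splits)
  have rec: "qint q (a + 2) * c + qint q a * c = (q + inverse q) * (qint q (a + 1) * c)" for a c
    using qint_rec[OF q, of a] by (simp add: distrib_right[symmetric] mult.assoc)
  have "qint q (\<beta> j + 1) * qint q ((\<beta> + eps j - eps (j+1)) i + 1)
        * qint q ((\<beta> + eps j - eps (j+1) + eps i - eps (i+1)) i + 1)
      + qint q (\<beta> i + 1) * qint q ((\<beta> + eps i - eps (i+1)) i + 1)
        * qint q ((\<beta> + eps i - eps (i+1) + eps i - eps (i+1)) j + 1)
      = (q + inverse q) * (qint q (\<beta> i + 1) * qint q ((\<beta> + eps i - eps (i+1)) j + 1)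
        * qint q ((\<beta> + eps i - eps (i+1) + eps j - eps (j+1)) i + 1))"
    \<comment> \<open>The first instance is for j = i + 1, where each e_i lowers entry j; the second
      for i = j + 1, where e_j lowers entry i.\<close>
    using cases rec[of "\<beta> j - 1" "qint q (\<beta> i + 1) * qint q (\<beta> i + 2)"]
      rec[of "\<beta> i" "qint q (\<beta> i + 1) * qint q (\<beta> j + 1)"]
    by (elim disjE; simp add: eps_apply ac_simps)
  then show ?thesis
    using assms
    by (simp only: Aq_op_xpow klinear_scale[OF klinear_Aq_op] scale_scale \<gamma> \<gamma>_def[symmetric]
        scale_add_left[symmetric])
qed

text \<open>Since f_i lowers entry i and takes its coefficient from entry i + 1, the two adjacency
  cases exchange roles compared with the e_i.\<close>

lemma opF_serre:
  assumes "i \<in> {1..n-1}" "j \<in> {1..n-1}" "cartan i j = -1"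
  shows "opF i (opF i (opF j (xpow n \<beta>))) + opF j (opF i (opF i (xpow n \<beta>)))
    = scale (q + inverse q) (opF i (opF j (opF i (xpow n \<beta>))))"
proof -
  define \<gamma> where "\<gamma> = \<beta> - eps j + eps (j+1) - eps i + eps (i+1) - eps i + eps (i+1)"
  have \<gamma>: "\<beta> - eps i + eps (i+1) - eps j + eps (j+1) - eps i + eps (i+1) = \<gamma>"
    "\<beta> - eps i + eps (i+1) - eps i + eps (i+1) - eps j + eps (j+1) = \<gamma>"
    by (simp_all add: \<gamma>_def algebra_simps)
  have cases: "j = i + 1 \<or> i = j + 1"
    using assms(3) by (auto simp: cartan_def split: if_splits)
  have rec: "qint q (a + 2) * c + qint q a * c = (q + inverse q) * (qint q (a + 1) * c)" for a c
    using qint_rec[OF q, of a] by (simp add: distrib_right[symmetric] mult.assoc)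
  have "qint q (\<beta> (j+1) + 1) * qint q ((\<beta> - eps j + eps (j+1)) (i+1) + 1)
        * qint q ((\<beta> - eps j + eps (j+1) - eps i + eps (i+1)) (i+1) + 1)
      + qint q (\<beta> (i+1) + 1) * qint q ((\<beta> - eps i + eps (i+1)) (i+1) + 1)
        * qint q ((\<beta> - eps i + eps (i+1) - eps i + eps (i+1)) (j+1) + 1)
      = (q + inverse q) * (qint q (\<beta> (i+1) + 1) * qint q ((\<beta> - eps i + eps (i+1)) (j+1) + 1)
        * qint q ((\<beta> - eps i + eps (i+1) - eps j + eps (j+1)) (i+1) + 1))"
    using cases rec[of "\<beta> (j+1) - 1" "qint q (\<beta> (i+1) + 1) * qint q (\<beta> (i+1) + 2)"]
      rec[of "\<beta> (i+1)" "qint q (\<beta> (i+1) + 1) * qint q (\<beta> (j+1) + 1)"]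
    by (elim disjE; simp add: eps_apply ac_simps)
  then show ?thesis
    using assms
    by (simp only: Aq_op_xpow klinear_scale[OF klinear_Aq_op] scale_scale \<gamma> \<gamma>_def[symmetric]
        scale_add_left[symmetric])
qed

lemma Uq_relations_act_zero:
  assumes u: "u \<in> Uq_relations q n" and x: "x \<in> Aq n"
  shows "falg_act (Aq_op q n) u x = 0"
proof (rule klinear_eq_on_Aq[OF _ _ x, where g = "\<lambda>x. 0"])
  show "klinear (falg_act (Aq_op q n) u)"
    by (rule klinear_falg_act) (rule klinear_Aq_op)
  show "klinear (\<lambda>x::(nat \<Rightarrow> int) \<Rightarrow>\<^sub>0 'k. 0 :: (nat \<Rightarrow> int) \<Rightarrow>\<^sub>0 'k)"
    by (simp add: klinear_iff)
  fix \<beta>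
  note left = klinear_falg_act_left[of "Aq_op q n"]
  note act = klinear_add[OF left] klinear_diff[OF left] klinear_scale[OF left]
    falg_act_mult[OF klinear_Aq_op] falg_act_gen falg_act_one
  show "falg_act (Aq_op q n) u (xpow n \<beta>) = 0"
    using u unfolding Uq_relations_def Let_def
    \<comment> \<open>The commutations of e_i with f_j, of distant e's and of distant f's are left
      to the final rules; the other families cancel by rewriting.\<close>
    by (elim UnE CollectE exE conjE)
       (simp_all only: act opK_opKinv opK_opE opK_opF opE_opF_same opE_serre[symmetric]
         opF_serre[symmetric] opK_opK diff_self
         add_diff_eq diff_add_eq,
        (rule right_minus_eq[THEN iffD2],
          (rule opE_opF_distinct opE_opE_commute opF_opF_commute; assumption))+)
qed

end

section \<open>The action of the small quantum group\<close>

context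
  fixes q :: "'k::field" and n l :: nat
  assumes q: "q \<noteq> 0" "q \<noteq> 1" "q \<noteq> -1" and l: "qchar q = l" "0 < l"
begin

lemma prod_qint_eq_zero: "(\<Prod>k<l. qint q (a + int k + 1)) = 0"
proof -
  \<comment> \<open>This residue makes a + k + 1 divisible by \<open>l\<close>: one of
    \<open>l\<close> consecutive integers is.\<close>
  define k where "k = nat ((- (a + 1)) mod int l)"
  have k: "k < l" "int k = (- (a + 1)) mod int l"
    using l by (simp_all add: k_def nat_less_iff)
  have "int l dvd a + int k + 1"
    using mod_add_right_eq[of "a + 1" "- (a + 1)" "int l"]
    unfolding k(2) dvd_eq_mod_eq_0 by (simp only: add_ac add.right_inverse mod_0)
  then obtain m where "a + int k + 1 = int l * m" ..
  then have "qint q (a + int k + 1) = 0"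
    using power_int_qchar[OF q l, of m] by (simp add: qint_eq_zero_iff[OF q])
  with k(1) show ?thesis
    by (intro prod_zero) auto
qed

lemma Aq_op_pow_eq_zero:
  assumes i: "i \<in> {1..n-1}" and x: "x \<in> Aq n" and g: "g = GenE i \<or> g = GenF i"
  shows "(Aq_op q n g ^^ l) x = 0"
proof (rule klinear_eq_on_Aq[OF _ _ x, where g = "\<lambda>x. 0"])
  show "klinear (\<lambda>x::(nat \<Rightarrow> int) \<Rightarrow>\<^sub>0 'k. 0 :: (nat \<Rightarrow> int) \<Rightarrow>\<^sub>0 'k)"
    by (simp add: klinear_iff)
  have "klinear (Aq_op q n g ^^ k)" for k
    using klinear_Aq_op[of q n g] by (induction k) (simp_all add: klinear_iff)
  then show "klinear (Aq_op q n g ^^ l)" .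
  fix \<beta>
  \<comment> \<open>The entry that grows, which alone determines the coefficient; thus e_i and f_i
    are treated together.\<close>
  define j where "j = (if g = GenE i then i else i + 1)"
  \<comment> \<open>The next coefficient depends on \<gamma> only through entry j, so the rest of
    \<gamma> stays unspecified.\<close>
  have "\<exists>\<gamma>. \<gamma> j = \<beta> j + int k \<and>
      (Aq_op q n g ^^ k) (xpow n \<beta>) = scale (\<Prod>m<k. qint q (\<beta> j + int m + 1)) (xpow n \<gamma>)" for k
  proof (induction k)
    case (Suc k)
    then obtain \<gamma> where \<gamma>: "\<gamma> j = \<beta> j + int k"
      "(Aq_op q n g ^^ k) (xpow n \<beta>) = scale (\<Prod>m<k. qint q (\<beta> j + int m + 1)) (xpow n \<gamma>)"
      by blast
    have "\<exists>\<delta>. \<delta> j = \<gamma> j + 1 \<and> Aq_op q n g (xpow n \<gamma>) = scale (qint q (\<gamma> j + 1)) (xpow n \<delta>)"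
      using g
    proof
      assume "g = GenE i"
      then show ?thesis
        by (intro exI[of _ "\<gamma> + eps i - eps (i+1)"]) (simp add: j_def Aq_op_xpow[OF i] eps_apply)
    next
      assume "g = GenF i"
      then show ?thesis
        by (intro exI[of _ "\<gamma> - eps i + eps (i+1)"]) (simp add: j_def Aq_op_xpow[OF i] eps_apply)
    qed
    then obtain \<delta> where
      "\<delta> j = \<gamma> j + 1" "Aq_op q n g (xpow n \<gamma>) = scale (qint q (\<gamma> j + 1)) (xpow n \<delta>)"
      by blast
    with \<gamma> show ?case
      by (intro exI[of _ \<delta>]) (simp add: klinear_scale[OF klinear_Aq_op])
  qed auto
  from this[of l] show "(Aq_op q n g ^^ l) (xpow n \<beta>) = 0"
    by (auto simp: prod_qint_eq_zero)
qed

lemma Aq_op_K_pow: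
  assumes i: "i \<in> {1..n-1}" and x: "x \<in> Aq n"
  shows "(Aq_op q n (GenK i) ^^ (2 * l)) x = x"
proof (rule klinear_eq_on_Aq[OF _ _ x, where g = "\<lambda>x. x"])
  show "klinear (\<lambda>x::(nat \<Rightarrow> int) \<Rightarrow>\<^sub>0 'k. x)"
    by (simp add: klinear_iff)
  have "klinear (Aq_op q n (GenK i) ^^ k)" for k
    using klinear_Aq_op[of q n "GenK i"] by (induction k) (simp_all add: klinear_iff)
  then show "klinear (Aq_op q n (GenK i) ^^ (2 * l))" .
  fix \<beta> :: "nat \<Rightarrow> int"
  define m where "m = \<beta> i - \<beta> (i+1)"
  have "(Aq_op q n (GenK i) ^^ k) (xpow n \<beta>) = scale (q powi (int k * m)) (xpow n \<beta>)" for k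
    using q by (induction k)
      (simp_all add: klinear_scale[OF klinear_Aq_op] Aq_op_K_xpow[OF i] m_def[simplified, symmetric]
        power_int_add[symmetric] algebra_simps)
  from this[of "2 * l"] show "(Aq_op q n (GenK i) ^^ (2 * l)) (xpow n \<beta>) = xpow n \<beta>"
    using power_int_qchar[OF q l, of m] by (simp add: mult.assoc)
qed

section \<open>Descent to the two quotients\<close>

lemma ideal_Uq_ideal: "ideal (Uq_ideal q n) (free_alg n)"
  unfolding Uq_ideal_def by (rule ring.genideal_ideal[OF ring_free_alg Uq_relations_closed])

lemma Uq_ideal_annihilates:
  "Uq_ideal q n \<subseteq> ring_action.annihilator (free_alg n) (Aq n) (falg_act (Aq_op q n))"
proof -
  interpret ring_action "free_alg n" "Aq n" "falg_act (Aq_op q n)" by (rule ring_action_Aq)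
  have "Uq_relations q n \<subseteq> annihilator"
    unfolding annihilator_def
    by (intro subsetI CollectI conjI ballI subsetD[OF Uq_relations_closed] Uq_relations_act_zero[OF q])
  then show ?thesis
    unfolding Uq_ideal_def by (rule genideal_minimal[OF ideal_annihilator])
qed

lemma ring_action_Uq: "ring_action (Uq q n) (Aq n) (quot_act (falg_act (Aq_op q n)))"
  unfolding Uq_def
  by (rule ring_action.ring_action_Quot[OF ring_action_Aq ideal_Uq_ideal Uq_ideal_annihilates zero_mem_Aq])

lemma Uq_gen_closed:
  assumes "gen_index g \<in> {1..n-1}"
  shows "Uq_gen q n g \<in> carrier (Uq q n)"
  unfolding Uq_def Uq_gen_def ring_action.carrier_Quot[OF ring_action_Aq]
  by (rule imageI) (rule falg_gen_closed[OF assms])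

lemma Uq_gen_act:
  assumes "gen_index g \<in> {1..n-1}" and "x \<in> Aq n"
  shows "quot_act (falg_act (Aq_op q n)) (Uq_gen q n g) x = Aq_op q n g x"
  unfolding Uq_gen_def
  using ring_action.quot_act_coset[OF ring_action_Aq ideal_Uq_ideal Uq_ideal_annihilates
      falg_gen_closed[OF assms(1)] assms(2)]
  by (simp add: falg_act_gen)

lemma Uq_gen_pow_act:
  assumes "gen_index g \<in> {1..n-1}" and "x \<in> Aq n"
  shows "quot_act (falg_act (Aq_op q n)) (Uq_gen q n g [^]\<^bsub>Uq q n\<^esub> (k::nat)) x = (Aq_op q n g ^^ k) x"
proof -
  have "(quot_act (falg_act (Aq_op q n)) (Uq_gen q n g) ^^ k) x = (Aq_op q n g ^^ k) x
      \<and> (Aq_op q n g ^^ k) x \<in> Aq n"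
    using assms by (induction k) (auto simp: Uq_gen_act Aq_op_mem_Aq)
  then show ?thesis
    using ring_action.act_pow[OF ring_action_Uq Uq_gen_closed] assms by simp
qed

definition small_uq_relations :: "'k falg set set" where
  "small_uq_relations =
     {Uq_gen q n (GenE i) [^]\<^bsub>Uq q n\<^esub> l | i. i \<in> {1..n-1}}
    \<union> {Uq_gen q n (GenF i) [^]\<^bsub>Uq q n\<^esub> l | i. i \<in> {1..n-1}}
    \<union> {Uq_gen q n (GenK i) [^]\<^bsub>Uq q n\<^esub> (2 * l) \<ominus>\<^bsub>Uq q n\<^esub> \<one>\<^bsub>Uq q n\<^esub> | i. i \<in> {1..n-1}}"

lemma small_uq_relations_annihilate:
  "small_uq_relations \<subseteq> ring_action.annihilator (Uq q n) (Aq n) (quot_act (falg_act (Aq_op q n)))"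
proof -
  interpret ring_action "Uq q n" "Aq n" "quot_act (falg_act (Aq_op q n))" by (rule ring_action_Uq)
  have "Uq_gen q n (GenE i) [^]\<^bsub>Uq q n\<^esub> l \<in> annihilator"
    "Uq_gen q n (GenF i) [^]\<^bsub>Uq q n\<^esub> l \<in> annihilator"
    "Uq_gen q n (GenK i) [^]\<^bsub>Uq q n\<^esub> (2 * l) \<ominus>\<^bsub>Uq q n\<^esub> \<one>\<^bsub>Uq q n\<^esub> \<in> annihilator"
    if i: "i \<in> {1..n-1}" for i
  proof -
    have c: "Uq_gen q n (GenE i) \<in> carrier (Uq q n)" "Uq_gen q n (GenF i) \<in> carrier (Uq q n)"
      "Uq_gen q n (GenK i) \<in> carrier (Uq q n)"
      using i by (simp_all add: Uq_gen_closed)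
    show "Uq_gen q n (GenE i) [^]\<^bsub>Uq q n\<^esub> l \<in> annihilator"
      "Uq_gen q n (GenF i) [^]\<^bsub>Uq q n\<^esub> l \<in> annihilator"
      using c i by (simp_all add: annihilator_def Uq_gen_pow_act Aq_op_pow_eq_zero)
    show "Uq_gen q n (GenK i) [^]\<^bsub>Uq q n\<^esub> (2 * l) \<ominus>\<^bsub>Uq q n\<^esub> \<one>\<^bsub>Uq q n\<^esub> \<in> annihilator"
      using c i by (simp add: annihilator_def act_diff act_one Uq_gen_pow_act Aq_op_K_pow)
  qed
  then show ?thesis
    unfolding small_uq_relations_def by blast
qed

text \<open>Intertwining for one fixed \<open>x\<close> suffices at each stage: the conclusion of
  the descent to \<open>Uq\<close> is the premise of the descent to the small quantum group.\<close>

lemma small_uq_intertwine: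
  assumes u: "u \<in> carrier (small_uq q l n)" and x: "x \<in> Aq n"
    and d: "\<And>u. u \<in> carrier (free_alg n)
      \<Longrightarrow> d (falg_act (Aq_op q n) u x) = falg_tensor_act (Aq_op q n) op' u (d x)"
  shows "d (uq_act (Aq_op q n) u x) = uq_tensor_act (Aq_op q n) op' u (d x)"
proof -
  interpret F: ring_action "free_alg n" "Aq n" "falg_act (Aq_op q n)" by (rule ring_action_Aq)
  interpret U: ring_action "Uq q n" "Aq n" "quot_act (falg_act (Aq_op q n))" by (rule ring_action_Uq)
  have sub: "small_uq_relations \<subseteq> carrier (Uq q n)"
    using small_uq_relations_annihilate by (auto simp: U.annihilator_def)
  have dU: "d (quot_act (falg_act (Aq_op q n)) C x)
      = quot_act (falg_tensor_act (Aq_op q n) op') C (d x)" if "C \<in> carrier (Uq q n)" for C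
    using that unfolding Uq_def
    by (rule F.quot_act_intertwine[OF ideal_Uq_ideal Uq_ideal_annihilates _ x]) (rule d)
  show ?thesis
    unfolding uq_act_def uq_tensor_act_def
  proof (rule U.quot_act_intertwine[OF U.genideal_ideal[OF sub]
        U.genideal_minimal[OF U.ideal_annihilator small_uq_relations_annihilate] _ x])
    show "d (quot_act (falg_act (Aq_op q n)) C x)
      = quot_act (falg_tensor_act (Aq_op q n) op') C (d x)" if "C \<in> carrier (Uq q n)" for C
      by (rule dU[OF that])
    show "u \<in> carrier (Uq q n Quot Idl\<^bsub>Uq q n\<^esub> small_uq_relations)"
      using u by (simp add: small_uq_def small_uq_relations_def)
  qed
qed

end

section \<open>The differential\<close>

lemma klinear_qdiff: "klinear (qdiff q n)"
  unfolding qdiff_def by (rule klinear_lin_ext)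

text \<open>Subtracting a unit vector cannot lead from outside \<open>Zplus n\<close> into it, so
  there every summand vanishes by itself.\<close>

lemma qdiff_xpow:
  fixes q :: "'k::field"
  shows "qdiff q n (xpow n \<beta>)
    = (\<Sum>j=1..n. scale (q powi (- star n (eps j) \<beta>)) (tensor (xpow n (\<beta> - eps j)) (dx j)))"
proof (cases "\<beta> \<in> Zplus n")
  case False
  have "xpow n (\<beta> - eps j) = (0 :: _ \<Rightarrow>\<^sub>0 'k)" if j: "j \<in> {1..n}" for j
  proof -
    have "\<beta> \<in> Zplus n" if *: "\<beta> - eps j \<in> Zplus n"
      unfolding Zplus_def
    proof (intro CollectI conjI ballI allI impI)
      fix i assume "i \<in> {1..n}"
      then have "0 \<le> (\<beta> - eps j) i" using * by (simp add: Zplus_def)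
      then show "0 \<le> \<beta> i" by (simp add: eps_def split: if_splits)
    next
      fix i assume "i \<notin> {1..n}"
      then have "(\<beta> - eps j) i = 0" "i \<noteq> j" using * j by (auto simp: Zplus_def)
      then show "\<beta> i = 0" by (simp add: eps_def)
    qed
    with False show ?thesis by (auto simp: xpow_def)
  qed
  then have "(\<Sum>j=1..n. scale (q powi (- star n (eps j) \<beta>)) (tensor (xpow n (\<beta> - eps j)) (dx j))) = 0"
    by (intro sum.neutral ballI) (simp only: tensor_zero scale_zero_right)
  with False show ?thesis
    by (simp add: xpow_def[of n \<beta>] klinear_zero[OF klinear_qdiff])
qed (simp add: qdiff_def xpow_def[of n \<beta>])

lemma star_eps:
  assumes "j \<in> {1..n}"
  shows "star n (eps j) \<alpha> = (\<Sum>k=1..<j. \<alpha> k)"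
proof -
  have "star n (eps j) \<alpha> = (\<Sum>k=1..n-1. if k < j then \<alpha> k else 0)"
    unfolding star_def
  proof (rule sum.cong[OF refl])
    fix k
    have "(\<Sum>i=k+1..n. eps j i * \<alpha> k) = (\<Sum>i=k+1..n. if i = j then \<alpha> k else 0)"
      by (rule sum.cong) (simp_all add: eps_def)
    then show "(\<Sum>i=k+1..n. eps j i * \<alpha> k) = (if k < j then \<alpha> k else 0)"
      using assms by simp
  qed
  also have "\<dots> = sum \<alpha> {k \<in> {1..n-1}. k < j}"
    by (subst sum.inter_filter) simp_all
  also have "{k \<in> {1..n-1}. k < j} = {1..<j}"
    using assms by auto
  finally show ?thesis .
qed

text \<open>By \<open>star_eps\<close> these are partial sums over the entries before j. A unit
  moved between entries i and i + 1 is noticed only if the cut falls between them, that is, for j =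
  i + 1.\<close>

lemma
  assumes "i \<in> {1..n-1}"
  shows star_eps_Suc: "star n (eps (i+1)) \<alpha> = star n (eps i) \<alpha> + \<alpha> i"
    and star_eps_shift: "j \<in> {1..n} \<Longrightarrow>
      star n (eps j) (\<alpha> + eps i - eps (i+1)) = star n (eps j) \<alpha> + of_bool (j = i + 1)"
    and star_eps_shift': "j \<in> {1..n} \<Longrightarrow>
      star n (eps j) (\<alpha> - eps i + eps (i+1)) = star n (eps j) \<alpha> - of_bool (j = i + 1)"
proof -
  have i: "i \<in> {1..n}" "i + 1 \<in> {1..n}"
    using assms by auto
  show "star n (eps (i+1)) \<alpha> = star n (eps i) \<alpha> + \<alpha> i"
    using i unfolding star_eps[OF i(1)] star_eps[OF i(2)] by simp
  have eps: "(\<Sum>k=1..<j. eps m k) = of_bool (m \<in> {1..<j})" for j m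
    by (simp add: eps_def)
  show "star n (eps j) (\<alpha> + eps i - eps (i+1)) = star n (eps j) \<alpha> + of_bool (j = i + 1)"
    "star n (eps j) (\<alpha> - eps i + eps (i+1)) = star n (eps j) \<alpha> - of_bool (j = i + 1)"
    if "j \<in> {1..n}"
    using that assms unfolding star_eps[OF that]
    by (auto simp only: func_plus fun_diff_def sum.distrib sum_subtractf eps of_bool_def
        atLeastLessThan_iff atLeastAtMost_iff split: if_split)
qed

lemma qdiff_mem_Aq_tensor_Lambda1: "x \<in> Aq n \<Longrightarrow> qdiff q n x \<in> Aq_tensor_Lambda1 n"
proof -
  have scale: "scale c y \<in> Aq_tensor_Lambda1 n" if "y \<in> Aq_tensor_Lambda1 n"
    for c and y :: "(nat \<Rightarrow> int) \<times> nat \<Rightarrow>\<^sub>0 'a"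
    using that by (fastforce simp: Aq_tensor_Lambda1_def in_keys_iff)
  have sum: "sum f A \<in> Aq_tensor_Lambda1 n" if "\<And>a. a \<in> A \<Longrightarrow> f a \<in> Aq_tensor_Lambda1 n"
    for A :: "'c set" and f :: "'c \<Rightarrow> ((nat \<Rightarrow> int) \<times> nat \<Rightarrow>\<^sub>0 'a)"
    using that keys_sum[of f A] by (fastforce simp: Aq_tensor_Lambda1_def)
  have "tensor (xpow n \<beta>) (dx j) \<in> Aq_tensor_Lambda1 n" if "j \<in> {1..n}" for \<beta> j
    using that by (simp add: Aq_tensor_Lambda1_def xpow_def dx_def)
  then show ?thesis
    unfolding qdiff_def lin_ext_def by (intro sum scale)
qed

lemma Lambda1_op_dx:
  "Lambda1_op q (GenE i) (dx j) = (if j = i + 1 then dx i else 0)"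
  "Lambda1_op q (GenF i) (dx j) = (if j = i then dx (i+1) else 0)"
  "Lambda1_op q (GenK i) (dx j) = scale (q powi (of_bool (i = j) - of_bool (i + 1 = j))) (dx j)"
  "Lambda1_op q (GenKinv i) (dx j)
    = scale (q powi (- (of_bool (i = j) - of_bool (i + 1 = j)))) (dx j)"
  by (simp_all add: Lambda1_op_def) (simp_all add: dx_def)

lemma falg2_act_comult_gen:
  "falg2_act op op' (comult_gen (GenE i)) y
    = tensor_map (op (GenE i)) (op' (GenK i)) y + tensor_map (\<lambda>v. v) (op' (GenE i)) y"
  "falg2_act op op' (comult_gen (GenF i)) y
    = tensor_map (op (GenF i)) (\<lambda>w. w) y + tensor_map (op (GenKinv i)) (op' (GenF i)) y"
  "falg2_act op op' (comult_gen (GenK i)) y = tensor_map (op (GenK i)) (op' (GenK i)) y"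
  "falg2_act op op' (comult_gen (GenKinv i)) y = tensor_map (op (GenKinv i)) (op' (GenKinv i)) y"
  unfolding comult_gen.simps falg_gen_def single_one[symmetric]
    klinear_add[OF klinear_falg2_act_left] falg2_act_tensor_word word_act_gen word_act_zero
  by (rule refl)+

lemma klinear_id: "klinear (\<lambda>v. v)"
  by (simp add: klinear_iff)

lemmas tensor_map_op =
  tensor_map_tensor[OF klinear_Aq_op klinear_Lambda1_op]
  tensor_map_tensor[OF klinear_Aq_op klinear_id]
  tensor_map_tensor[OF klinear_id klinear_Lambda1_op]

section \<open>Compatibility of d with the generators\<close>

context
  fixes q :: "'k::field" and n :: nat
  assumes q: "q \<noteq> 0" "q \<noteq> 1" "q \<noteq> -1"
begin

lemma qdiff_E_xpow:
  assumes i: "i \<in> {1..n-1}"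
  shows "qdiff q n (Aq_op q n (GenE i) (xpow n \<beta>))
    = falg2_act (Aq_op q n) (Lambda1_op q) (comult_gen (GenE i)) (qdiff q n (xpow n \<beta>))"
proof -
  define T where "T \<gamma> j = (tensor (xpow n \<gamma>) (dx j) :: _ \<Rightarrow>\<^sub>0 'k)" for \<gamma> j
  define c where "c j = q powi (- star n (eps j) \<beta>)" for j
  define \<gamma> where "\<gamma> j = \<beta> + eps i - eps (i+1) - eps j" for j
  \<comment> \<open>The summand of 1 \<otimes> e_i on the \<open>dx (i+1)\<close> term: e_i turns
    \<open>dx (i+1)\<close> into \<open>dx i\<close>, and the remaining exponent equals
    \<open>\<gamma> i\<close>.\<close>
  define S where "S = scale (c (i+1)) (T (\<beta> - eps (i+1)) i)"
  have c_Suc: "c (i+1) = c i * q powi (- \<beta> i)"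
    using q unfolding c_def star_eps_Suc[OF i] by (simp add: power_int_add[symmetric])
  have i': "i \<in> {1..n}" "i + 1 \<in> {1..n}"
    using i by auto
  have "qdiff q n (Aq_op q n (GenE i) (xpow n \<beta>))
      = (\<Sum>j=1..n. scale (qint q (\<beta> i + 1) * q powi (- (star n (eps j) \<beta> + of_bool (j = i + 1)))) (T (\<gamma> j) j))"
    using i by (simp add: Aq_op_E_xpow klinear_scale[OF klinear_qdiff] qdiff_xpow scale_sum_right
        star_eps_shift[simplified] T_def \<gamma>_def)
  also have "\<dots> = (\<Sum>j=1..n. scale (c j * (qint q ((\<beta> - eps j) i + 1)
      * q powi (of_bool (i = j) - of_bool (i + 1 = j)))) (T (\<gamma> j) j) + (if j = i then S else 0))"
  proof (rule sum.cong[OF refl])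
    fix j assume "j \<in> {1..n}"
    consider "j = i" | "j = i + 1" | "j \<noteq> i" "j \<noteq> i + 1" by blast
    then show "scale (qint q (\<beta> i + 1) * q powi (- (star n (eps j) \<beta> + of_bool (j = i + 1)))) (T (\<gamma> j) j)
      = scale (c j * (qint q ((\<beta> - eps j) i + 1)
        * q powi (of_bool (i = j) - of_bool (i + 1 = j)))) (T (\<gamma> j) j) + (if j = i then S else 0)"
    proof cases
      case 1
      have "S = scale (c i * q powi (- \<beta> i)) (T (\<gamma> j) j)"
        unfolding S_def c_Suc using 1 by (simp add: \<gamma>_def)
      then show ?thesis
        using 1 qint_add_one[OF q, of "\<beta> i"]
        by (simp add: c_def eps_apply scale_add_left[symmetric] algebra_simps)
    next
      \<comment> \<open>The factor q^(-1) has two sources: the shifted \<open>star\<close> exponent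
        on the left, and K_i acting on \<open>dx (i+1)\<close> on the right.\<close>
      case 2
      then show ?thesis
        using q by (simp add: c_def eps_apply power_int_diff power_int_minus field_simps)
    next
      case 3
      then show ?thesis
        by (simp add: c_def eps_apply mult.commute)
    qed
  qed
  \<comment> \<open>\<open>S\<close> is needed in the summand of \<open>dx i\<close> but arises from
    that of \<open>dx (i+1)\<close>; reindexing it leaves the total unchanged.\<close>
  also have "\<dots> = (\<Sum>j=1..n. scale (c j * (qint q ((\<beta> - eps j) i + 1)
      * q powi (of_bool (i = j) - of_bool (i + 1 = j)))) (T (\<gamma> j) j))
      + (\<Sum>j=1..n. if j = i + 1 then S else 0)"
    using i' by (simp add: sum.distrib)
  also have "\<dots> = falg2_act (Aq_op q n) (Lambda1_op q) (comult_gen (GenE i)) (qdiff q n (xpow n \<beta>))"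
    unfolding falg2_act_comult_gen qdiff_xpow klinear_sum[OF klinear_tensor_map]
      klinear_scale[OF klinear_tensor_map] tensor_map_op Aq_op_E_xpow[OF i] Lambda1_op_dx
    by (intro arg_cong2[of _ _ _ _ "(+)"] sum.cong refl)
       (auto simp: T_def \<gamma>_def c_def S_def algebra_simps)
  finally show ?thesis .
qed

lemma qdiff_F_xpow:
  assumes i: "i \<in> {1..n-1}"
  shows "qdiff q n (Aq_op q n (GenF i) (xpow n \<beta>))
    = falg2_act (Aq_op q n) (Lambda1_op q) (comult_gen (GenF i)) (qdiff q n (xpow n \<beta>))"
proof -
  define T where "T \<gamma> j = (tensor (xpow n \<gamma>) (dx j) :: _ \<Rightarrow>\<^sub>0 'k)" for \<gamma> j
  define c where "c j = q powi (- star n (eps j) \<beta>)" for j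
  define \<gamma> where "\<gamma> j = \<beta> - eps i + eps (i+1) - eps j" for j
  \<comment> \<open>The summand of K_i^(-1) \<otimes> f_i on the \<open>dx i\<close> term; the -1 in
    the exponent comes from K_i^(-1) acting on x^(\<beta> - \<open>eps i\<close>).\<close>
  define S where "S = scale (c i * q powi (- (\<beta> i - 1 - \<beta> (i+1)))) (T (\<beta> - eps i) (i+1))"
  have "c (i+1) = c i * q powi (- \<beta> i)"
    using q unfolding c_def star_eps_Suc[OF i] by (simp add: power_int_add[symmetric])
  \<comment> \<open>Expressed through \<open>c (i+1)\<close>, the power becomes the correction term
    in \<open>qint_add_one'\<close> at \<beta>(i+1).\<close>
  then have c_Suc: "c i * q powi (- (\<beta> i - 1 - \<beta> (i+1))) = c (i+1) * q powi (\<beta> (i+1) + 1)"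
    using q by (simp add: power_int_add power_int_diff power_int_minus field_simps)
  have i': "i \<in> {1..n}" "i + 1 \<in> {1..n}"
    using i by auto
  have "qdiff q n (Aq_op q n (GenF i) (xpow n \<beta>))
      = (\<Sum>j=1..n. scale (qint q (\<beta> (i+1) + 1) * q powi (- (star n (eps j) \<beta> - of_bool (j = i + 1)))) (T (\<gamma> j) j))"
    using i by (simp add: Aq_op_F_xpow klinear_scale[OF klinear_qdiff] qdiff_xpow scale_sum_right
        star_eps_shift'[simplified] T_def \<gamma>_def)
  also have "\<dots> = (\<Sum>j=1..n. scale (c j * qint q ((\<beta> - eps j) (i+1) + 1)) (T (\<gamma> j) j)
      + (if j = i + 1 then S else 0))"
  proof (rule sum.cong[OF refl])
    fix j assume "j \<in> {1..n}"
    consider "j = i" | "j = i + 1" | "j \<noteq> i" "j \<noteq> i + 1" by blast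
    then show "scale (qint q (\<beta> (i+1) + 1) * q powi (- (star n (eps j) \<beta> - of_bool (j = i + 1)))) (T (\<gamma> j) j)
      = scale (c j * qint q ((\<beta> - eps j) (i+1) + 1)) (T (\<gamma> j) j) + (if j = i + 1 then S else 0)"
    proof cases
      case 2
      have "S = scale (c j * q powi (\<beta> (i+1) + 1)) (T (\<gamma> j) j)"
        unfolding S_def c_Suc using 2 by (simp add: \<gamma>_def)
      moreover have "q powi (- (star n (eps j) \<beta> - 1)) = c j * q"
        using q by (simp add: c_def power_int_diff power_int_minus divide_inverse mult.commute)
      ultimately show ?thesis
        using 2 arg_cong[OF qint_add_one'[OF q, of "\<beta> (i+1)"], of "(*) (c j)"]
        by (simp add: eps_apply scale_add_left[symmetric] distrib_left ac_simps)
    qed (simp_all add: c_def eps_apply mult.commute)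
  qed
  also have "\<dots> = (\<Sum>j=1..n. scale (c j * qint q ((\<beta> - eps j) (i+1) + 1)) (T (\<gamma> j) j))
      + (\<Sum>j=1..n. if j = i then S else 0)"
    using i' by (simp add: sum.distrib)
  also have "\<dots> = falg2_act (Aq_op q n) (Lambda1_op q) (comult_gen (GenF i)) (qdiff q n (xpow n \<beta>))"
    unfolding falg2_act_comult_gen qdiff_xpow klinear_sum[OF klinear_tensor_map]
      klinear_scale[OF klinear_tensor_map] tensor_map_op Aq_op_F_xpow[OF i] Aq_op_Kinv_xpow[OF i]
      Lambda1_op_dx
    by (intro arg_cong2[of _ _ _ _ "(+)"] sum.cong refl)
       (auto simp: T_def \<gamma>_def c_def S_def eps_apply algebra_simps)
  finally show ?thesis .
qed

text \<open>Every summand of dx^(\<beta>) has the weight of x^(\<beta>): the unit removed from entry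
  j is restored by \<open>dx j\<close>.\<close>

lemma qdiff_K_xpow:
  assumes i: "i \<in> {1..n-1}" and g: "g = GenK i \<or> g = GenKinv i"
  shows "qdiff q n (Aq_op q n g (xpow n \<beta>))
    = falg2_act (Aq_op q n) (Lambda1_op q) (comult_gen g) (qdiff q n (xpow n \<beta>))"
proof -
  define w where "w j = (\<beta> - eps j) i - (\<beta> - eps j) (i+1)" for j
  have w: "\<beta> i - \<beta> (i+1) = w j + (of_bool (i = j) - of_bool (i + 1 = j))" for j
    by (simp add: w_def eps_apply)
  have K: "q powi w j * q powi (of_bool (i = j) - of_bool (i + 1 = j)) = q powi (\<beta> i - \<beta> (i+1))"
    "q powi (- w j) * q powi (- (of_bool (i = j) - of_bool (i + 1 = j)))
      = q powi (- (\<beta> i - \<beta> (i+1)))" for j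
    using q by (simp_all only: w[of j] minus_add_distrib power_int_add simp_thms mult.commute)
  from g show ?thesis
    by (elim disjE; simp only: falg2_act_comult_gen qdiff_xpow klinear_sum[OF klinear_tensor_map]
        klinear_scale[OF klinear_tensor_map] tensor_map_op Aq_op_K_xpow[OF i] Aq_op_Kinv_xpow[OF i]
        Lambda1_op_dx klinear_scale[OF klinear_qdiff] scale_sum_right tensor_scale scale_scale
        w_def[symmetric] K mult.commute)
qed

lemma qdiff_Aq_op:
  assumes g: "gen_index g \<in> {1..n-1}" and x: "x \<in> Aq n"
  shows "qdiff q n (Aq_op q n g x)
    = falg2_act (Aq_op q n) (Lambda1_op q) (comult_gen g) (qdiff q n x)"
proof (rule klinear_eq_on_Aq[OF _ _ x])
  show "klinear (\<lambda>x. qdiff q n (Aq_op q n g x))"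
    by (rule klinear_comp[OF klinear_qdiff klinear_Aq_op])
  show "klinear (\<lambda>x. falg2_act (Aq_op q n) (Lambda1_op q) (comult_gen g) (qdiff q n x))"
    by (rule klinear_comp[OF klinear_falg2_act klinear_qdiff]; rule klinear_Aq_op klinear_Lambda1_op)
  fix \<beta>
  show "qdiff q n (Aq_op q n g (xpow n \<beta>))
    = falg2_act (Aq_op q n) (Lambda1_op q) (comult_gen g) (qdiff q n (xpow n \<beta>))"
    using g by (cases g) (simp_all only: gen_index.simps qdiff_E_xpow qdiff_F_xpow qdiff_K_xpow simp_thms)
qed

lemma qdiff_falg_act:
  assumes "u \<in> carrier (free_alg n)" and "x \<in> Aq n"
  shows "qdiff q n (falg_act (Aq_op q n) u x)
    = falg_tensor_act (Aq_op q n) (Lambda1_op q) u (qdiff q n x)"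
  using assms
  by (intro falg_tensor_act_intertwine[where M = "Aq n" and n = n])
     (auto intro: klinear_Aq_op klinear_Lambda1_op klinear_qdiff Aq_op_mem_Aq qdiff_Aq_op)

end

theorem proposition4p2:
  fixes q :: "'k::{alg_closed_field, field_char_0}" and n l :: nat
  assumes "n \<ge> 3"
    and "q \<noteq> 0" and "q \<noteq> 1" and "q \<noteq> -1"
    and "qchar q = l" and "l \<ge> 3"
  shows "Vector_Spaces.linear scale scale (qdiff q n)
    \<and> qdiff q n ` Aq n \<subseteq> Aq_tensor_Lambda1 n
    \<and> (\<forall>u\<in>carrier (small_uq q l n). \<forall>x\<in>Aq n.
         qdiff q n (uq_act (Aq_op q n) u x)
           = uq_tensor_act (Aq_op q n) (Lambda1_op q) u (qdiff q n x))"
proof (intro conjI ballI)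
  show "klinear (qdiff q n)"
    by (rule klinear_qdiff)
  show "qdiff q n ` Aq n \<subseteq> Aq_tensor_Lambda1 n"
    using qdiff_mem_Aq_tensor_Lambda1 by blast
  fix u and x :: "(nat \<Rightarrow> int) \<Rightarrow>\<^sub>0 'k"
  assume u: "u \<in> carrier (small_uq q l n)" and x: "x \<in> Aq n"
  have l: "0 < l"
    using assms by simp
  show "qdiff q n (uq_act (Aq_op q n) u x)
      = uq_tensor_act (Aq_op q n) (Lambda1_op q) u (qdiff q n x)"
    using small_uq_intertwine[OF assms(2-5) l u x] qdiff_falg_act[OF assms(2-4) _ x] .
qed

end
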